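(* Let $V$ be a finite dimensional real vector space, $B\subseteq V$ a compact convex polyhedral $0$-neighborhood with associated asymmetric polyhedral norm $\nu$ and dual polyhedron $B^\vee\subseteq V^\vee$, and let $\widehat V$ be the bordification of $V$ with respect to $\delta(u,v)=\nu(u-v)$, identified via the bijection $\Phi$ with $\bigsqcup\{V_L\mid L\in\Sigma\cup\{K\}\}$. Then the map $$c:\bigsqcup\{V_L\mid L\in\Sigma\cup\{K\}\}\longrightarrow B^\vee,\qquad c(p+H_L)=c_L(p)\ \ (L\in\Sigma,\ p\in V),\qquad c(p)=c_K(p)\ \ (p\in V=V_K),$$ is a homeomorphism between $\widehat V$ and $B^\vee$ that maps $V_L$ homeomorphically onto the open face $U_L$, for each $L\in\Sigma\cup\{K\}$.
   Context: $V$ is a finite dimensional real vector space with dual $V^\vee$, endowed with a Euclidean norm $\|\cdot\|$, and $0$ is the base point. $B\subseteq V$ is a compact convex polyhedral neighborhood of $0$ with codimension-1 faces $A_0,\dots,A_m$, and $K=\{0,\dots,m\}$. For each $j\in K$, $\xi_j\in V^\vee$ is the unique linear functional with $A_j=\{v\in B\mid \xi_j(v)=1\}$; thus $B=\{u\in V\mid \xi_j(u)\le 1\text{ for all }j\in K\}$, and the asymmetric norm with unit ball $B$ is $\nu(u)=\max\{\xi_0(u),\dots,\xi_m(u)\}$. Put $\delta(u,v)=\nu(u-v)$. The dual polyhedron is $B^\vee=\{\xi\in V^\vee\mid \xi(u)\le1\text{ for all }u\in B\}$, which is the convex hull of $\xi_0,\dots,\xi_m$. A nonempty subset $L\subseteq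 K$ is a dual face if there is $v\in V$ with $\nu(v)=1$ and $L=\{k\in K\mid \xi_k(v)=1\}$; $\Sigma$ is the set of all dual faces. The proper (nonempty) faces of $B^\vee$ are precisely the convex hulls of $\{\xi_\ell\mid\ell\in L\}$, $L\in\Sigma$. For $L\in\Sigma\cup\{K\}$, $B_L^\vee$ is the face of $B^\vee$ with vertex set $\{\xi_\ell\mid\ell\in L\}$ (so $B_K^\vee=B^\vee$), and $U_L\subseteq B_L^\vee$ is the corresponding open face (the relative interior of $B_L^\vee$). For nonempty $L\subseteq K$: $\nu_L(u)=\max\{\xi_\ell(u)\mid \ell\in L\}$ and $H_L=\{u\in V\mid \xi_k(u)=\xi_\ell(u)\text{ for all }k,\ell\in L\}$. Put $V_K=V$ and $V_L=V/H_L$ for $L\in\Sigma$. The bordification $\widehat V$ is the closure of $\{u\mapsto\delta(p,u)-\delta(p,0)\mid p\in V\}$ in the space of continuous functions $f:V\to\mathbb R$ with $f(0)=0$, in the topology of uniform convergence on bounded sets. Its elements are exactly the functions $v\mapsto\nu(p-v)-\nu(p)$ with $p\in V$ and $v\mapsto\nu_L(p-v)-\nu_L(p)$ with $p\in V$, $L\in\Sigma$. The map $\Phi:\widehat V\to\bigsqcup\{V_L\mid L\in\Sigma\cup\{K\}\}$ sending the former to $p\in V_K$ and the latter to $p+H_L\in V_L$ is a bijection, and the disjoint union carries the topology making $\Phi$ a homeomorphism. For $L\in\Sigma\cup\{K\}$ and $p\in V$ put $$a_L(p)=\sum_{k\in L}\exp(\xi_k(p))\,\xi_k\in V^\vee,\qquad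 b_L(p)=\sum_{k\in L}\exp(\xi_k(p))\in\mathbb R,\qquad c_L(p)=\frac{a_L(p)}{b_L(p)};$$ $c_L(p)$ depends only on $p+H_L$. *)

theory Defs
  imports "HOL-Analysis.Analysis"
begin

text \<open>The vector space is a type \<open>'a::euclidean_space\<close>; its dual is the type
  \<open>'a \<Rightarrow>\<^sub>L real\<close>, which contains every linear functional because the space is finite
  dimensional.  The facets are indexed by a finite set \<open>K\<close> of naturals, with \<open>\<xi> j\<close> the
  functional attached to the \<open>j\<close>-th facet.\<close>

definition pointed_continuous_functions :: "('a::euclidean_space \<Rightarrow> real) set" where
  "pointed_continuous_functions = {f. continuous_on UNIV f \<and> f 0 = 0}"

text \<open>Uniform convergence on bounded sets.  The sets of functions \<open>g\<close> below form a neighbourhood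
  basis at \<open>f\<close>, but need not be open themselves, as the bound \<open>< e\<close> is only pointwise.\<close>

definition bounded_uniform_open :: "('a::euclidean_space \<Rightarrow> real) set \<Rightarrow> bool" where
  "bounded_uniform_open U \<longleftrightarrow> U \<subseteq> pointed_continuous_functions \<and>
     (\<forall>f\<in>U. \<exists>S e. bounded S \<and> e > 0 \<and>
        {g \<in> pointed_continuous_functions. \<forall>x\<in>S. \<bar>g x - f x\<bar> < e} \<subseteq> U)"

definition bounded_uniform_topology :: "('a::euclidean_space \<Rightarrow> real) topology" where
  "bounded_uniform_topology = topology bounded_uniform_open"

lemma bounded_uniform_openE:
  assumes "bounded_uniform_open U" and "f \<in> U"
  obtains S e where "bounded S" and "e > 0"
    and "{g \<in> pointed_continuous_functions. \<forall>x\<in>S. \<bar>g x - f x\<bar> < e} \<subseteq> U"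
proof -
  from assms have "\<exists>S e. bounded S \<and> e > 0 \<and>
        {g \<in> pointed_continuous_functions. \<forall>x\<in>S. \<bar>g x - f x\<bar> < e} \<subseteq> U"
    unfolding bounded_uniform_open_def by (elim conjE bspec)
  then show thesis by (elim exE conjE) (rule that)
qed

lemma istopology_bounded_uniform_open: "istopology bounded_uniform_open"
proof -
  have "bounded_uniform_open (U \<inter> V)"
    if U: "bounded_uniform_open U" and V: "bounded_uniform_open V"
    for U V :: "('a \<Rightarrow> real) set"
    unfolding bounded_uniform_open_def
  proof (intro conjI ballI)
    show "U \<inter> V \<subseteq> pointed_continuous_functions"
      using U by (auto simp: bounded_uniform_open_def)
    fix f assume "f \<in> U \<inter> V"
    then have "f \<in> U" "f \<in> V" by auto
    obtain S d where S: "bounded S" "d > 0"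
      "{g \<in> pointed_continuous_functions. \<forall>x\<in>S. \<bar>g x - f x\<bar> < d} \<subseteq> U"
      by (rule bounded_uniform_openE[OF U \<open>f \<in> U\<close>])
    obtain T e where T: "bounded T" "e > 0"
      "{g \<in> pointed_continuous_functions. \<forall>x\<in>T. \<bar>g x - f x\<bar> < e} \<subseteq> V"
      by (rule bounded_uniform_openE[OF V \<open>f \<in> V\<close>])
    have "bounded (S \<union> T)" "min d e > 0"
      using S(1,2) T(1,2) by auto
    moreover have "{g \<in> pointed_continuous_functions. \<forall>x\<in>S \<union> T. \<bar>g x - f x\<bar> < min d e} \<subseteq> U \<inter> V"
    proof
      fix g assume "g \<in> {g \<in> pointed_continuous_functions. \<forall>x\<in>S \<union> T. \<bar>g x - f x\<bar> < min d e}"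
      then have "g \<in> {g \<in> pointed_continuous_functions. \<forall>x\<in>S. \<bar>g x - f x\<bar> < d}"
        "g \<in> {g \<in> pointed_continuous_functions. \<forall>x\<in>T. \<bar>g x - f x\<bar> < e}"
        by simp_all
      with S(3) T(3) show "g \<in> U \<inter> V" by (meson IntI subsetD)
    qed
    ultimately show "\<exists>S e. bounded S \<and> e > 0 \<and>
        {g \<in> pointed_continuous_functions. \<forall>x\<in>S. \<bar>g x - f x\<bar> < e} \<subseteq> U \<inter> V"
      by (intro exI[of _ "S \<union> T"] exI[of _ "min d e"] conjI)
  qed
  moreover have "bounded_uniform_open (\<Union>\<U>)"
    if "\<forall>U\<in>\<U>. bounded_uniform_open U" for \<U> :: "('a \<Rightarrow> real) set set"
    unfolding bounded_uniform_open_def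
  proof (intro conjI ballI)
    show "\<Union>\<U> \<subseteq> pointed_continuous_functions"
      using that by (auto simp: bounded_uniform_open_def)
    fix f assume "f \<in> \<Union>\<U>"
    then obtain U where "U \<in> \<U>" "f \<in> U" by blast
    with that have "bounded_uniform_open U" by blast
    then obtain S e where S: "bounded S" "e > 0"
      "{g \<in> pointed_continuous_functions. \<forall>x\<in>S. \<bar>g x - f x\<bar> < e} \<subseteq> U"
      using \<open>f \<in> U\<close> by (rule bounded_uniform_openE)
    from S(3) \<open>U \<in> \<U>\<close>
    have "{g \<in> pointed_continuous_functions. \<forall>x\<in>S. \<bar>g x - f x\<bar> < e} \<subseteq> \<Union>\<U>"
      by (meson Union_upper subset_trans)
    with S(1,2) show "\<exists>S e. bounded S \<and> e > 0 \<and>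
        {g \<in> pointed_continuous_functions. \<forall>x\<in>S. \<bar>g x - f x\<bar> < e} \<subseteq> \<Union>\<U>"
      by (intro exI[of _ S] exI[of _ e] conjI)
  qed
  ultimately show ?thesis
    unfolding istopology_def by (intro conjI allI impI)
qed

lemma openin_bounded_uniform_topology:
  "openin bounded_uniform_topology U \<longleftrightarrow> bounded_uniform_open U"
  by (simp add: bounded_uniform_topology_def istopology_bounded_uniform_open topology_inverse')

lemma topspace_bounded_uniform_topology:
  "topspace bounded_uniform_topology = pointed_continuous_functions"
proof -
  have "bounded_uniform_open (pointed_continuous_functions :: ('a \<Rightarrow> real) set)"
    unfolding bounded_uniform_open_def by (auto intro!: exI[of _ "{}"] exI[of _ "1::real"])
  then show ?thesis
    by (metis bounded_uniform_open_def openin_bounded_uniform_topology openin_subset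
        openin_topspace subset_antisym)
qed

text \<open>The final topology on \<open>Y\<close> with respect to \<open>f\<close>.  For surjective \<open>f\<close> this is the quotient
  topology, and for bijective \<open>f\<close> it is the unique topology making \<open>f\<close> a homeomorphism.\<close>

definition coinduced_topology :: "'a topology \<Rightarrow> ('a \<Rightarrow> 'b) \<Rightarrow> 'b set \<Rightarrow> 'b topology" where
  "coinduced_topology X f Y =
     topology (\<lambda>U. U \<subseteq> Y \<and> openin X {x \<in> topspace X. f x \<in> U})"

lemma openin_coinduced_topology:
  "openin (coinduced_topology X f Y) U \<longleftrightarrow> U \<subseteq> Y \<and> openin X {x \<in> topspace X. f x \<in> U}"
proof -
  have Int: "{x \<in> topspace X. f x \<in> S \<inter> T} =
      {x \<in> topspace X. f x \<in> S} \<inter> {x \<in> topspace X. f x \<in> T}" for S T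
    by blast
  have Un: "{x \<in> topspace X. f x \<in> \<Union>\<U>} = \<Union>((\<lambda>U. {x \<in> topspace X. f x \<in> U}) ` \<U>)" for \<U>
    by blast
  have "istopology (\<lambda>U. U \<subseteq> Y \<and> openin X {x \<in> topspace X. f x \<in> U})"
    unfolding istopology_def
  proof (intro conjI allI impI)
    fix S T
    assume "S \<subseteq> Y \<and> openin X {x \<in> topspace X. f x \<in> S}"
      and "T \<subseteq> Y \<and> openin X {x \<in> topspace X. f x \<in> T}"
    then show "S \<inter> T \<subseteq> Y" "openin X {x \<in> topspace X. f x \<in> S \<inter> T}"
      unfolding Int by (auto intro: openin_Int)
  next
    fix \<U>
    assume "\<forall>U\<in>\<U>. U \<subseteq> Y \<and> openin X {x \<in> topspace X. f x \<in> U}"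
    then show "\<Union>\<U> \<subseteq> Y" "openin X {x \<in> topspace X. f x \<in> \<Union>\<U>}"
      by (auto simp only: Un intro!: openin_Union)
  qed
  then show ?thesis
    by (simp add: coinduced_topology_def topology_inverse')
qed

lemma topspace_coinduced_topology:
  assumes "f ` topspace X \<subseteq> Y"
  shows "topspace (coinduced_topology X f Y) = Y"
proof
  show "topspace (coinduced_topology X f Y) \<subseteq> Y"
    using openin_coinduced_topology[of X f Y] openin_topspace by blast
  have "{x \<in> topspace X. f x \<in> Y} = topspace X" using assms by blast
  then show "Y \<subseteq> topspace (coinduced_topology X f Y)"
    by (intro openin_subset) (simp add: openin_coinduced_topology)
qed

lemma homeomorphic_map_coinduced_topology:
  assumes "bij_betw f (topspace X) Y"
  shows "homeomorphic_map X (coinduced_topology X f Y) f"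
proof -
  have "f ` topspace X = Y" "inj_on f (topspace X)"
    using assms by (auto simp: bij_betw_def)
  moreover from this have "topspace (coinduced_topology X f Y) = Y"
    by (simp add: topspace_coinduced_topology)
  ultimately show ?thesis
    by (auto simp: homeomorphic_map_def quotient_map_def openin_coinduced_topology)
qed

definition partial_norm ::
    "(nat \<Rightarrow> 'a::euclidean_space \<Rightarrow>\<^sub>L real) \<Rightarrow> nat set \<Rightarrow> 'a \<Rightarrow> real" where
  "partial_norm \<xi> L u = Max ((\<lambda>l. blinfun_apply (\<xi> l) u) ` L)"

text \<open>\<open>partial_norm \<xi> L\<close> is $\nu_L$, and for the full index set \<open>partial_norm \<xi> K\<close> is $\nu$.\<close>

definition asym_dist ::
    "(nat \<Rightarrow> 'a::euclidean_space \<Rightarrow>\<^sub>L real) \<Rightarrow> nat set \<Rightarrow> 'a \<Rightarrow> 'a \<Rightarrow> real" where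
  "asym_dist \<xi> K u v = partial_norm \<xi> K (u - v)"

definition bordification ::
    "(nat \<Rightarrow> 'a::euclidean_space \<Rightarrow>\<^sub>L real) \<Rightarrow> nat set \<Rightarrow> ('a \<Rightarrow> real) topology" where
  "bordification \<xi> K = subtopology bounded_uniform_topology
     (bounded_uniform_topology closure_of
        range (\<lambda>p u. asym_dist \<xi> K p u - asym_dist \<xi> K p 0))"

definition dual_faces ::
    "(nat \<Rightarrow> 'a::euclidean_space \<Rightarrow>\<^sub>L real) \<Rightarrow> nat set \<Rightarrow> nat set set" where
  "dual_faces \<xi> K = {L. L \<subseteq> K \<and> L \<noteq> {} \<and>
     (\<exists>v. partial_norm \<xi> K v = 1 \<and> L = {k \<in> K. blinfun_apply (\<xi> k) v = 1})}"

definition dual_polyhedron :: "'a::euclidean_space set \<Rightarrow> ('a \<Rightarrow>\<^sub>L real) set" where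
  "dual_polyhedron B = {\<zeta>. \<forall>u\<in>B. blinfun_apply \<zeta> u \<le> 1}"

definition closed_face ::
    "(nat \<Rightarrow> 'a::euclidean_space \<Rightarrow>\<^sub>L real) \<Rightarrow> nat set \<Rightarrow> ('a \<Rightarrow>\<^sub>L real) set" where
  "closed_face \<xi> L = convex hull (\<xi> ` L)"

definition open_face ::
    "(nat \<Rightarrow> 'a::euclidean_space \<Rightarrow>\<^sub>L real) \<Rightarrow> nat set \<Rightarrow> ('a \<Rightarrow>\<^sub>L real) set" where
  "open_face \<xi> L = rel_interior (closed_face \<xi> L)"

definition eq_subspace ::
    "(nat \<Rightarrow> 'a::euclidean_space \<Rightarrow>\<^sub>L real) \<Rightarrow> nat set \<Rightarrow> 'a set" where
  "eq_subspace \<xi> L = {u. \<forall>k\<in>L. \<forall>l\<in>L. blinfun_apply (\<xi> k) u = blinfun_apply (\<xi> l) u}"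

definition eq_coset ::
    "(nat \<Rightarrow> 'a::euclidean_space \<Rightarrow>\<^sub>L real) \<Rightarrow> nat set \<Rightarrow> 'a \<Rightarrow> 'a set" where
  "eq_coset \<xi> L p = (\<lambda>h. p + h) ` eq_subspace \<xi> L"

text \<open>A point of the disjoint union is \<open>Inl p\<close> for a point \<open>p\<close> of $V_K = V$, or \<open>Inr (L, C)\<close>
  for a coset \<open>C\<close> in $V_L = V/H_L$; \<open>stratum_proj \<xi> K L\<close> is the projection $V \to V_L$.
  The case split is unambiguous, as \<open>K\<close> is not itself a dual face of a compact \<open>B\<close>.\<close>

definition stratum_proj ::
    "(nat \<Rightarrow> 'a::euclidean_space \<Rightarrow>\<^sub>L real) \<Rightarrow> nat set \<Rightarrow> nat set \<Rightarrow> 'a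
      \<Rightarrow> 'a + nat set \<times> 'a set" where
  "stratum_proj \<xi> K L p = (if L = K then Inl p else Inr (L, eq_coset \<xi> L p))"

definition stratum ::
    "(nat \<Rightarrow> 'a::euclidean_space \<Rightarrow>\<^sub>L real) \<Rightarrow> nat set \<Rightarrow> nat set
      \<Rightarrow> ('a + nat set \<times> 'a set) set" where
  "stratum \<xi> K L = range (stratum_proj \<xi> K L)"

definition stratum_topology ::
    "(nat \<Rightarrow> 'a::euclidean_space \<Rightarrow>\<^sub>L real) \<Rightarrow> nat set \<Rightarrow> nat set
      \<Rightarrow> ('a + nat set \<times> 'a set) topology" where
  "stratum_topology \<xi> K L = coinduced_topology euclidean (stratum_proj \<xi> K L) (stratum \<xi> K L)"

definition strata ::
    "(nat \<Rightarrow> 'a::euclidean_space \<Rightarrow>\<^sub>L real) \<Rightarrow> nat set \<Rightarrow> ('a + nat set \<times> 'a set) set" where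
  "strata \<xi> K = (\<Union>L \<in> dual_faces \<xi> K \<union> {K}. stratum \<xi> K L)"

definition horofunction ::
    "(nat \<Rightarrow> 'a::euclidean_space \<Rightarrow>\<^sub>L real) \<Rightarrow> nat set \<Rightarrow> 'a \<Rightarrow> 'a \<Rightarrow> real" where
  "horofunction \<xi> L p = (\<lambda>v. partial_norm \<xi> L (p - v) - partial_norm \<xi> L p)"

definition Phi ::
    "(nat \<Rightarrow> 'a::euclidean_space \<Rightarrow>\<^sub>L real) \<Rightarrow> nat set \<Rightarrow> ('a \<Rightarrow> real)
      \<Rightarrow> 'a + nat set \<times> 'a set" where
  "Phi \<xi> K f = (THE x. \<exists>L \<in> dual_faces \<xi> K \<union> {K}. \<exists>p.
     f = horofunction \<xi> L p \<and> x = stratum_proj \<xi> K L p)"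

definition strata_topology ::
    "(nat \<Rightarrow> 'a::euclidean_space \<Rightarrow>\<^sub>L real) \<Rightarrow> nat set
      \<Rightarrow> ('a + nat set \<times> 'a set) topology" where
  "strata_topology \<xi> K = coinduced_topology (bordification \<xi> K) (Phi \<xi> K) (strata \<xi> K)"

definition a_vec ::
    "(nat \<Rightarrow> 'a::euclidean_space \<Rightarrow>\<^sub>L real) \<Rightarrow> nat set \<Rightarrow> 'a \<Rightarrow> 'a \<Rightarrow>\<^sub>L real" where
  "a_vec \<xi> L p = (\<Sum>k\<in>L. exp (blinfun_apply (\<xi> k) p) *\<^sub>R \<xi> k)"

definition b_val ::
    "(nat \<Rightarrow> 'a::euclidean_space \<Rightarrow>\<^sub>L real) \<Rightarrow> nat set \<Rightarrow> 'a \<Rightarrow> real" where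
  "b_val \<xi> L p = (\<Sum>k\<in>L. exp (blinfun_apply (\<xi> k) p))"

definition c_vec ::
    "(nat \<Rightarrow> 'a::euclidean_space \<Rightarrow>\<^sub>L real) \<Rightarrow> nat set \<Rightarrow> 'a \<Rightarrow> 'a \<Rightarrow>\<^sub>L real" where
  "c_vec \<xi> L p = a_vec \<xi> L p /\<^sub>R b_val \<xi> L p"

text \<open>On a coset, \<open>c_map\<close> evaluates \<open>c_vec\<close> at an arbitrary representative; by \<open>c_map_proj\<close>
  below the result does not depend on the choice.\<close>

definition c_map ::
    "(nat \<Rightarrow> 'a::euclidean_space \<Rightarrow>\<^sub>L real) \<Rightarrow> nat set \<Rightarrow> 'a + nat set \<times> 'a set
      \<Rightarrow> 'a \<Rightarrow>\<^sub>L real" where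
  "c_map \<xi> K x =
     (case x of Inl p \<Rightarrow> c_vec \<xi> K p | Inr (L, C) \<Rightarrow> c_vec \<xi> L (SOME p. p \<in> C))"

lemma c_vec_eq_coset:
  assumes "q \<in> eq_coset \<xi> L p"
  shows "c_vec \<xi> L q = c_vec \<xi> L p"
proof (cases "L = {}")
  case True
  then show ?thesis by (simp add: c_vec_def a_vec_def)
next
  case False
  then obtain l where "l \<in> L" by blast
  obtain h where q: "q = p + h" and "h \<in> eq_subspace \<xi> L"
    using assms unfolding eq_coset_def by blast
  with \<open>l \<in> L\<close> have h: "blinfun_apply (\<xi> k) h = blinfun_apply (\<xi> l) h" if "k \<in> L" for k
    using that unfolding eq_subspace_def by blast
  let ?t = "exp (blinfun_apply (\<xi> l) h)"
  have e: "exp (blinfun_apply (\<xi> k) q) = ?t * exp (blinfun_apply (\<xi> k) p)" if "k \<in> L" for k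
    using h[OF that] by (simp add: q blinfun.add_right exp_add mult.commute)
  have "a_vec \<xi> L q = ?t *\<^sub>R a_vec \<xi> L p"
    unfolding a_vec_def scaleR_sum_right by (intro sum.cong) (simp_all add: e)
  moreover have "b_val \<xi> L q = ?t * b_val \<xi> L p"
    unfolding b_val_def sum_distrib_left by (intro sum.cong) (simp_all add: e)
  ultimately show ?thesis
    by (simp add: c_vec_def)
qed

lemma c_map_proj: "c_map \<xi> K (stratum_proj \<xi> K L p) = c_vec \<xi> L p"
proof -
  have "p \<in> eq_coset \<xi> L p"
    unfolding eq_coset_def eq_subspace_def by (auto simp: image_iff intro!: exI[of _ 0])
  then have "(SOME q. q \<in> eq_coset \<xi> L p) \<in> eq_coset \<xi> L p"
    by (rule someI)
  then show ?thesis
    by (simp add: c_map_def stratum_proj_def c_vec_eq_coset)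
qed

end

theory Submission
  imports Defs "HOL-Real_Asymp.Real_Asymp"
begin

text \<open>Assign to \<open>p + H\<^bsub>L\<^esub>\<close> the probability weights proportional to \<open>exp (\<xi>\<^sub>k p)\<close>, \<open>k \<in> L\<close>, and
  \<open>0\<close> off \<open>L\<close>.  The set \<open>T\<close> of all weights so obtained is cut out of the simplex by the
  binomial equations \<open>w\<^sup>\<alpha> = w\<^sup>\<beta>\<close>, where \<open>\<alpha>, \<beta> \<ge> 0\<close> have the same total mass and the same
  moment \<open>\<Sum> \<alpha>\<^sub>k \<xi>\<^sub>k = \<Sum> \<beta>\<^sub>k \<xi>\<^sub>k\<close>; so \<open>T\<close> is compact.  The map \<open>c\<close> becomes the moment map
  \<open>w \<mapsto> \<Sum> w\<^sub>k \<xi>\<^sub>k\<close>.  It is injective on \<open>T\<close>: if \<open>v\<close> and \<open>w\<close> have the same moment, taking them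
  as exponents gives equal supports and \<open>\<Sum> (v\<^sub>k - w\<^sub>k) (ln v\<^sub>k - ln w\<^sub>k) = 0\<close>.  It is onto the
  dual polyhedron, because weights of maximal entropy with a prescribed moment lie in \<open>T\<close>.
  On the other side, \<open>w \<mapsto> (v \<mapsto> ln (max w\<^sub>k exp (- \<xi>\<^sub>k v)) - ln (max w\<^sub>k))\<close> is jointly continuous and
  injective, and sends the weights of \<open>p + H\<^bsub>L\<^esub>\<close> to the horofunction of \<open>p\<close> and \<open>L\<close>.  Since the
  weights of full support are dense in \<open>T\<close>, its image is the bordification.  Both maps are thus
  homeomorphisms from the compact space \<open>T\<close>.\<close>

section \<open>Weights satisfying binomial equations\<close>

definition weight_simplex :: "'i set \<Rightarrow> ('i \<Rightarrow> real) set" where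
  "weight_simplex K = {w. (\<forall>k. k \<notin> K \<longrightarrow> w k = 0) \<and> (\<forall>k\<in>K. 0 \<le> w k) \<and> sum w K = 1}"

definition moment :: "('i \<Rightarrow> 'v::real_normed_vector) \<Rightarrow> 'i set \<Rightarrow> ('i \<Rightarrow> real) \<Rightarrow> 'v" where
  "moment \<xi> K w = (\<Sum>k\<in>K. w k *\<^sub>R \<xi> k)"

text \<open>Only positive exponents enter the product: since \<open>0 powr 0 = 0\<close>, a factor
  with exponent 0 would make the monomial vanish at a vanishing weight.\<close>

definition monomial :: "'i set \<Rightarrow> ('i \<Rightarrow> real) \<Rightarrow> ('i \<Rightarrow> real) \<Rightarrow> real" where
  "monomial K \<alpha> w = (\<Prod>k\<in>{k\<in>K. 0 < \<alpha> k}. w k powr \<alpha> k)"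

text \<open>Exponents are real rather than integral, as the functionals need not be rational. For
  rational functionals this models the nonnegative part of a projective toric variety.\<close>

definition toric_set :: "('i \<Rightarrow> 'v::real_normed_vector) \<Rightarrow> 'i set \<Rightarrow> ('i \<Rightarrow> real) set" where
  "toric_set \<xi> K = {w \<in> weight_simplex K. \<forall>\<alpha> \<beta>.
     (\<forall>k\<in>K. 0 \<le> \<alpha> k) \<longrightarrow> (\<forall>k\<in>K. 0 \<le> \<beta> k) \<longrightarrow> sum \<alpha> K = sum \<beta> K \<longrightarrow>
     moment \<xi> K \<alpha> = moment \<xi> K \<beta> \<longrightarrow> monomial K \<alpha> w = monomial K \<beta> w}"

lemma toric_setD:
  assumes "w \<in> toric_set \<xi> K" "\<And>k. k \<in> K \<Longrightarrow> 0 \<le> \<alpha> k" "\<And>k. k \<in> K \<Longrightarrow> 0 \<le> \<beta> k"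
    "sum \<alpha> K = sum \<beta> K" "moment \<xi> K \<alpha> = moment \<xi> K \<beta>"
  shows "monomial K \<alpha> w = monomial K \<beta> w"
  using assms unfolding toric_set_def by blast

lemma toric_set_subset_simplex: "toric_set \<xi> K \<subseteq> weight_simplex K"
  by (auto simp: toric_set_def)

lemma weight_simplexD:
  assumes "w \<in> weight_simplex K"
  shows "k \<notin> K \<Longrightarrow> w k = 0" "0 \<le> w k" "sum w K = 1"
  using assms by (cases "k \<in> K"; auto simp: weight_simplex_def)+

lemma monomial_eq_0:
  assumes "finite K" "k \<in> K" "0 < \<alpha> k" "w k = 0"
  shows "monomial K \<alpha> w = 0"
  unfolding monomial_def using assms by (intro prod_zero) auto

lemma monomial_eq_exp:
  assumes "finite K" "\<And>k. k \<in> K \<Longrightarrow> 0 \<le> \<alpha> k" "\<And>k. k \<in> K \<Longrightarrow> 0 < \<alpha> k \<Longrightarrow> 0 < w k"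
  shows "monomial K \<alpha> w = exp (\<Sum>k\<in>K. \<alpha> k * ln (w k))"
proof -
  have "monomial K \<alpha> w = (\<Prod>k\<in>{k\<in>K. 0 < \<alpha> k}. exp (\<alpha> k * ln (w k)))"
    unfolding monomial_def using assms(3)
    by (intro prod.cong) (auto simp: powr_def dest!: assms(3))
  also have "\<dots> = exp (\<Sum>k\<in>{k\<in>K. 0 < \<alpha> k}. \<alpha> k * ln (w k))"
    using assms(1) by (simp add: exp_sum)
  also have "(\<Sum>k\<in>{k\<in>K. 0 < \<alpha> k}. \<alpha> k * ln (w k)) = (\<Sum>k\<in>K. \<alpha> k * ln (w k))"
    using assms(1,2) by (intro sum.mono_neutral_left) (auto simp: order.order_iff_strict)
  finally show ?thesis .
qed

text \<open>A zero weight \<open>w k\<close> would make the monomial of \<open>\<beta>\<close>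
  vanish, while the monomial of \<open>\<alpha>\<close> is a product of positive numbers.\<close>

lemma toric_set_support:
  assumes K: "finite K" and w: "w \<in> toric_set \<xi> K"
    and "\<And>k. k \<in> K \<Longrightarrow> 0 \<le> \<alpha> k" "\<And>k. k \<in> K \<Longrightarrow> 0 \<le> \<beta> k"
    and "sum \<alpha> K = sum \<beta> K" "moment \<xi> K \<alpha> = moment \<xi> K \<beta>"
    and supp: "\<And>k. k \<in> K \<Longrightarrow> 0 < \<alpha> k \<Longrightarrow> 0 < w k" and k: "k \<in> K" "0 < \<beta> k"
  shows "0 < w k"
proof (rule ccontr)
  assume "\<not> 0 < w k"
  moreover have "w \<in> weight_simplex K" using w toric_set_subset_simplex by blast
  ultimately have "w k = 0" using weight_simplexD(2)[of w K k] by simp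
  then have "monomial K \<beta> w = 0" using K k by (intro monomial_eq_0)
  moreover have "monomial K \<alpha> w = monomial K \<beta> w" using assms by (intro toric_setD[OF w]) auto
  moreover have "monomial K \<alpha> w = exp (\<Sum>k\<in>K. \<alpha> k * ln (w k))"
    using K assms(3) supp by (intro monomial_eq_exp) auto
  ultimately show False by simp
qed

text \<open>The logarithm of the binomial equation; by \<open>toric_set_support\<close>,
  \<open>\<beta>\<close> charges only positive weights, just as \<open>\<alpha>\<close>
  does.\<close>

lemma toric_set_ln_relation:
  assumes K: "finite K" and w: "w \<in> toric_set \<xi> K"
    and a: "\<And>k. k \<in> K \<Longrightarrow> 0 \<le> \<alpha> k" and b: "\<And>k. k \<in> K \<Longrightarrow> 0 \<le> \<beta> k"
    and eq: "sum \<alpha> K = sum \<beta> K" "moment \<xi> K \<alpha> = moment \<xi> K \<beta>"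
    and supp: "\<And>k. k \<in> K \<Longrightarrow> 0 < \<alpha> k \<Longrightarrow> 0 < w k"
  shows "(\<Sum>k\<in>K. \<alpha> k * ln (w k)) = (\<Sum>k\<in>K. \<beta> k * ln (w k))"
proof -
  have "monomial K \<alpha> w = exp (\<Sum>k\<in>K. \<alpha> k * ln (w k))"
    using K a supp by (intro monomial_eq_exp) auto
  moreover have "monomial K \<beta> w = exp (\<Sum>k\<in>K. \<beta> k * ln (w k))"
    using K b toric_set_support[OF K w a b eq supp] by (intro monomial_eq_exp) auto
  moreover have "monomial K \<alpha> w = monomial K \<beta> w" using assms by (intro toric_setD[OF w]) auto
  ultimately show ?thesis by simp
qed

lemma moment_blinfun_apply:
  "blinfun_apply (moment \<xi> K w) v = (\<Sum>k\<in>K. w k * blinfun_apply (\<xi> k) v)"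
  by (simp add: moment_def blinfun.sum_left blinfun.scaleR_left)

text \<open>An affine relation \<open>d\<close> is the difference of its positive and negative
  parts, which have equal mass and moment and so are admissible exponents.\<close>

lemma
  assumes K: "finite K" and w: "w \<in> toric_set \<xi> K"
    and d: "sum d K = 0" "moment \<xi> K d = 0"
    and supp: "\<And>k. k \<in> K \<Longrightarrow> 0 < d k \<Longrightarrow> 0 < w k"
  shows toric_set_support_signed: "k \<in> K \<Longrightarrow> d k < 0 \<Longrightarrow> 0 < w k"
    and toric_set_ln_relation_signed: "(\<Sum>k\<in>K. d k * ln (w k)) = 0"
proof -
  define \<alpha> where "\<alpha> k = max (d k) 0" for k
  define \<beta> where "\<beta> k = max (- d k) 0" for k
  have eq: "sum \<alpha> K = sum \<beta> K" "moment \<xi> K \<alpha> = moment \<xi> K \<beta>"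
  proof -
    have dab: "d k = \<alpha> k - \<beta> k" for k unfolding \<alpha>_def \<beta>_def by auto
    show "sum \<alpha> K = sum \<beta> K" using d(1) by (simp add: dab sum_subtractf)
    show "moment \<xi> K \<alpha> = moment \<xi> K \<beta>"
      using d(2) by (simp add: dab moment_def sum_subtractf scaleR_left_diff_distrib)
  qed
  have nn: "0 \<le> \<alpha> k" "0 \<le> \<beta> k" for k unfolding \<alpha>_def \<beta>_def by auto
  have supp': "0 < w k" if "k \<in> K" "0 < \<alpha> k" for k
    using supp[OF that(1)] that(2) unfolding \<alpha>_def by (auto simp: max_def split: if_splits)
  show "0 < w k" if "k \<in> K" "d k < 0" for k
    using toric_set_support[OF K w nn(1) nn(2) eq supp' that(1)] that(2) unfolding \<beta>_def by simp
  have "(\<Sum>k\<in>K. \<alpha> k * ln (w k)) = (\<Sum>k\<in>K. \<beta> k * ln (w k))"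
    by (rule toric_set_ln_relation[OF K w nn(1) nn(2) eq supp'])
  moreover have "(\<Sum>k\<in>K. d k * ln (w k)) = (\<Sum>k\<in>K. \<alpha> k * ln (w k)) - (\<Sum>k\<in>K. \<beta> k * ln (w k))"
    unfolding sum_subtractf[symmetric] \<alpha>_def \<beta>_def
    by (intro sum.cong) (auto simp: max_def)
  ultimately show "(\<Sum>k\<in>K. d k * ln (w k)) = 0" by simp
qed

section \<open>Compactness of the weights and injectivity of the moment map\<close>

text \<open>Weights are functions on the whole index type under the product topology. The simplex is
  closed in the cube with sides \<open>{0..1}\<close>, which is compact by Tychonoff's
  theorem.\<close>

lemma compact_weight_simplex:
  assumes "finite K"
  shows "compact (weight_simplex K)"
proof -
  have "compactin (product_topology (\<lambda>i. euclidean) UNIV) (PiE UNIV (\<lambda>_. {0..1::real}))"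
    unfolding compactin_PiE by simp
  then have box: "compact (PiE UNIV (\<lambda>_. {0..1::real}))"
    by (simp add: euclidean_product_topology)
  have cont: "continuous_on UNIV (\<lambda>w. sum w K :: real)" for K :: "'a set"
    by (rule continuous_on_sum[where f = "\<lambda>i w. w i"]) (rule continuous_on_product_coordinates)
  have "closed (weight_simplex K)"
    unfolding weight_simplex_def Ball_def
    by (intro closed_Collect_conj closed_Collect_all closed_Collect_imp closed_Collect_eq
        closed_Collect_le continuous_on_product_coordinates cont continuous_on_const) auto
  moreover have "w k \<le> 1" if w: "w \<in> weight_simplex K" for w k
  proof (cases "k \<in> K")
    case True
    then have "w k \<le> sum w K" using assms weight_simplexD(2)[OF w] by (intro member_le_sum) auto
    then show ?thesis using weight_simplexD(3)[OF w] by simp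
  qed (use weight_simplexD(1)[OF w] in auto)
  then have "weight_simplex K \<subseteq> PiE UNIV (\<lambda>_. {0..1::real})"
    by (auto simp: weight_simplexD(2))
  ultimately show ?thesis
    using compact_Int_closed[OF box, of "weight_simplex K"] by (simp add: inf.absorb2)
qed

lemma continuous_on_moment: "continuous_on S (moment \<xi> K)"
proof -
  have "continuous_on UNIV (moment \<xi> K)" unfolding moment_def
    by (intro continuous_on_sum continuous_on_scaleR continuous_on_product_coordinates
        continuous_on_const)
  then show ?thesis using continuous_on_subset by blast
qed

text \<open>\<open>powr\<close> is continuous at base 0 because the exponents are positive and the
  bases stay nonnegative on the simplex.\<close>

lemma continuous_on_monomial:
  fixes K :: "'i set"
  shows "continuous_on (weight_simplex K) (monomial K \<alpha>)"
proof -
  have c: "continuous_on (weight_simplex K) (\<lambda>w. w k)" for k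
    by (rule continuous_on_subset[OF continuous_on_product_coordinates]) simp
  have "continuous_on (weight_simplex K) (\<lambda>w. w k powr \<alpha> k)" if "0 < \<alpha> k" for k
    using that by (intro continuous_on_powr' c continuous_on_const) (auto simp: weight_simplexD(2))
  then have "continuous_on (weight_simplex K) (\<lambda>w. \<Prod>k\<in>{k\<in>K. 0 < \<alpha> k}. w k powr \<alpha> k)"
    by (intro continuous_on_prod) auto
  then show ?thesis unfolding monomial_def .
qed

lemma compact_toric_set:
  assumes "finite K"
  shows "compact (toric_set \<xi> K)"
proof -
  define R where "R = {(\<alpha>, \<beta>). (\<forall>k\<in>K. 0 \<le> \<alpha> k) \<and> (\<forall>k\<in>K. 0 \<le> \<beta> k) \<and> sum \<alpha> K = sum \<beta> K \<and>
     moment \<xi> K \<alpha> = moment \<xi> K \<beta>}"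
  have cl: "closedin (top_of_set (weight_simplex K))
      {w \<in> weight_simplex K. monomial K \<alpha> w = monomial K \<beta> w}" for \<alpha> \<beta>
  proof -
    have "continuous_on (weight_simplex K) (\<lambda>w. monomial K \<alpha> w - monomial K \<beta> w)"
      by (intro continuous_on_diff continuous_on_monomial)
    from continuous_closedin_preimage[OF this, of "{0}"] show ?thesis
      by (simp add: vimage_def Int_def)
  qed
  have eq: "toric_set \<xi> K = (\<Inter>(\<alpha>,\<beta>)\<in>R. {w \<in> weight_simplex K. monomial K \<alpha> w = monomial K \<beta> w})"
  proof -
    \<comment> \<open>The zero pair of exponents makes \<open>R\<close> nonempty, which keeps the
      intersection inside the simplex.\<close>
    have "(\<lambda>_. 0, \<lambda>_. 0) \<in> R" unfolding R_def by auto
    moreover have "w \<in> toric_set \<xi> K \<longleftrightarrow>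
        w \<in> weight_simplex K \<and> (\<forall>(\<alpha>,\<beta>)\<in>R. monomial K \<alpha> w = monomial K \<beta> w)" for w
      unfolding toric_set_def R_def by (simp, blast)
    ultimately show ?thesis by auto
  qed
  have "(\<lambda>_. 0, \<lambda>_. 0) \<in> R" unfolding R_def by auto
  then have "closedin (top_of_set (weight_simplex K)) (toric_set \<xi> K)"
    unfolding eq by (intro closedin_Inter) (auto intro: cl)
  then show ?thesis using compact_weight_simplex[OF assms] closedin_compact by blast
qed

lemma inj_on_moment_toric_set:
  assumes K: "finite K"
  shows "inj_on (moment \<xi> K) (toric_set \<xi> K)"
proof (rule inj_onI)
  fix v w assume v: "v \<in> toric_set \<xi> K" and w: "w \<in> toric_set \<xi> K"
    and eq: "moment \<xi> K v = moment \<xi> K w"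
  have sv: "v \<in> weight_simplex K" and sw: "w \<in> weight_simplex K"
    using v w toric_set_subset_simplex by auto
  note vD = weight_simplexD[OF sv] and wD = weight_simplexD[OF sw]
  have s: "sum v K = sum w K" using vD wD by simp
  \<comment> \<open>With \<open>\<alpha> = v\<close> and \<open>\<beta> = w\<close> the support
    condition for \<open>v\<close> is trivial, and likewise with the roles exchanged.\<close>
  have supp: "0 < v k \<longleftrightarrow> 0 < w k" if "k \<in> K" for k
    using toric_set_support[OF K v vD(2) wD(2) s eq] toric_set_support[OF K w wD(2) vD(2) s[symmetric] eq[symmetric]] that
    by blast
  have "(\<Sum>k\<in>K. v k * ln (v k)) = (\<Sum>k\<in>K. w k * ln (v k))"
    by (rule toric_set_ln_relation[OF K v vD(2) wD(2) s eq])
  moreover have "(\<Sum>k\<in>K. v k * ln (w k)) = (\<Sum>k\<in>K. w k * ln (w k))"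
    by (rule toric_set_ln_relation[OF K w vD(2) wD(2) s eq]) (use supp in auto)
  ultimately have "(\<Sum>k\<in>K. (v k - w k) * (ln (v k) - ln (w k))) = 0"
    by (simp add: algebra_simps sum.distrib sum_subtractf)
  \<comment> \<open>\<open>ln\<close> is increasing, so all terms are nonnegative and a vanishing
    sum forces each of them to vanish.\<close>
  moreover have nn: "0 \<le> (v k - w k) * (ln (v k) - ln (w k))" if "k \<in> K" for k
  proof (cases "0 < v k")
    case True
    then have "0 < w k" using supp that by simp
    then show ?thesis using True
      by (cases "v k \<le> w k") (auto intro!: mult_nonneg_nonneg mult_nonpos_nonpos)
  next
    case False
    then show ?thesis using supp[OF that] vD(2)[of k] wD(2)[of k] by simp
  qed
  ultimately have z: "(v k - w k) * (ln (v k) - ln (w k)) = 0" if "k \<in> K" for k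
    using sum_nonneg_eq_0_iff[OF K, of "\<lambda>k. (v k - w k) * (ln (v k) - ln (w k))"] that by simp
  show "v = w"
  proof
    fix k show "v k = w k"
    proof (cases "k \<in> K \<and> 0 < v k")
      case True
      then show ?thesis using z[of k] supp[of k] by auto
    next
      case False
      then show ?thesis using supp[of k] vD(1,2)[of k] wD(1,2)[of k] by force
    qed
  qed
qed

section \<open>Weights of maximal entropy with a prescribed moment\<close>

text \<open>The factor \<open>x\<close> makes the value at 0 equal to 0, whatever
  \<open>ln 0\<close> is, and this is the limit from the right.\<close>

lemma continuous_on_mult_ln: "continuous_on {0..} (\<lambda>x::real. x * ln x)"
  unfolding continuous_on_def
proof
  fix x :: real assume "x \<in> {0..}"
  then consider "x = 0" | "x > 0" by force
  then show "((\<lambda>x. x * ln x) \<longlongrightarrow> x * ln x) (at x within {0..})"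
  proof cases
    case 1
    have "((\<lambda>x::real. x * ln x) \<longlongrightarrow> 0) (at_right 0)" by real_asymp
    moreover have "at (0::real) within {0..} = at_right 0"
      by (simp add: at_within_Ici_at_right)
    ultimately show ?thesis using 1 by simp
  next
    case 2
    then have "isCont (\<lambda>x. x * ln x) x" by (intro continuous_intros) auto
    then show ?thesis unfolding isCont_def by (rule tendsto_within_subset) auto
  qed
qed

text \<open>The graph of the convex function \<open>x ln x\<close> lies above its tangent at
  \<open>y\<close>; this is \<open>ln z \<le> z - 1\<close> at \<open>z = y / x\<close>.\<close>

lemma mult_ln_tangent:
  fixes x y :: real
  assumes "0 \<le> x" "0 < y"
  shows "y * ln y + (x - y) * (ln y + 1) \<le> x * ln x"
proof (cases "x = 0")
  case False
  then have "ln (y / x) \<le> y / x - 1" using assms by (intro ln_le_minus_one) auto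
  then have "x * ln (y / x) \<le> x * (y / x - 1)" using assms by (intro mult_left_mono) auto
  then show ?thesis using False assms by (simp add: ln_div algebra_simps)
qed (use assms in \<open>simp add: algebra_simps\<close>)

text \<open>First-order optimality in the direction \<open>\<beta> - \<alpha>\<close>.  The function \<open>x ln x\<close>
  has derivative \<open>-\<infinity>\<close> at \<open>0\<close>, which is why \<open>\<beta>\<close> cannot charge a vanishing weight.\<close>

lemma entropy_minimizer_direction:
  assumes K: "finite K" and w: "w \<in> weight_simplex K"
    and min: "\<And>u. u \<in> weight_simplex K \<Longrightarrow> moment \<xi> K u = moment \<xi> K w \<Longrightarrow>
        (\<Sum>k\<in>K. w k * ln (w k)) \<le> (\<Sum>k\<in>K. u k * ln (u k))"
    and a: "\<And>k. k \<in> K \<Longrightarrow> 0 \<le> \<alpha> k" and b: "\<And>k. k \<in> K \<Longrightarrow> 0 \<le> \<beta> k"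
    and eq: "sum \<alpha> K = sum \<beta> K" "moment \<xi> K \<alpha> = moment \<xi> K \<beta>"
    and supp: "\<And>k. k \<in> K \<Longrightarrow> 0 < \<alpha> k \<Longrightarrow> 0 < w k"
  shows "(\<forall>k\<in>K. 0 < \<beta> k \<longrightarrow> 0 < w k) \<and>
         (\<Sum>k\<in>K. \<alpha> k * ln (w k)) \<le> (\<Sum>k\<in>K. \<beta> k * ln (w k))"
proof -
  define d where "d k = \<beta> k - \<alpha> k" for k
  note wD = weight_simplexD[OF w]
  \<comment> \<open>At a vanishing weight \<open>\<alpha>\<close> is 0 by the support condition, so
    moving in direction \<open>d\<close> keeps that weight nonnegative.\<close>
  have d0: "0 \<le> d k" if "k \<in> K" "w k = 0" for k
    using a[OF that(1)] b[OF that(1)] supp[OF that(1)] that(2) unfolding d_def by fastforce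
  obtain T where T: "0 < T" "\<And>k t. k \<in> K \<Longrightarrow> 0 < w k \<Longrightarrow> 0 < t \<Longrightarrow> t < T \<Longrightarrow> 0 < w k + t * d k"
  proof -
    have "\<exists>T>0. \<forall>k\<in>{k\<in>K. 0 < w k}. \<forall>t. 0 < t \<longrightarrow> t < T \<longrightarrow> 0 < w k + t * d k"
    proof -
      have "\<forall>\<^sub>F t in at_right 0. \<forall>k\<in>{k\<in>K. 0 < w k}. 0 < w k + t * d k"
      proof (rule eventually_ball_finite)
        show "finite {k\<in>K. 0 < w k}" using K by simp
        show "\<forall>k\<in>{k\<in>K. 0 < w k}. \<forall>\<^sub>F t in at_right 0. 0 < w k + t * d k"
        proof
          fix k assume k: "k \<in> {k\<in>K. 0 < w k}"
          have "((\<lambda>t. w k + t * d k) \<longlongrightarrow> w k + 0 * d k) (at_right 0)"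
            by (intro tendsto_intros)
          then show "\<forall>\<^sub>F t in at_right 0. 0 < w k + t * d k"
            using k by (auto dest: order_tendstoD(1))
        qed
      qed
      then show ?thesis unfolding eventually_at_right_field by (metis (no_types, lifting))
    qed
    then show thesis using that by auto
  qed
  \<comment> \<open>Since \<open>d\<close> has total mass 0, \<open>g t\<close> is the derivative of
    the negative entropy along \<open>w + t d\<close>.\<close>
  define g where "g t = (\<Sum>k\<in>K. d k * ln (w k + t * d k))" for t
  have alt: "0 < w k + t * d k \<or> (w k = 0 \<and> d k = 0)" if "k \<in> K" "0 < t" "t < T" for k t
    using T(2)[OF that(1) _ that(2,3)] wD(2)[of k] d0[OF that(1)] that(2)
    by (metis add_0 less_eq_real_def mult_pos_pos)
  have sd: "sum d K = 0" unfolding d_def using eq(1) by (simp add: sum_subtractf)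
  have md: "(\<Sum>k\<in>K. d k *\<^sub>R \<xi> k) = 0"
    using eq(2) unfolding d_def moment_def by (simp add: scaleR_left_diff_distrib sum_subtractf)
  have g_nonneg: "0 \<le> g t" if t: "0 < t" "t < T" for t
  proof -
    define u where "u k = (if k \<in> K then w k + t * d k else 0)" for k
    have "u \<in> weight_simplex K"
      using alt[OF _ t] wD(3) sd unfolding weight_simplex_def u_def
      by (force simp: sum.distrib sum_distrib_left[symmetric])
    moreover have "moment \<xi> K u = moment \<xi> K w"
    proof -
      have "moment \<xi> K u = moment \<xi> K w + t *\<^sub>R (\<Sum>k\<in>K. d k *\<^sub>R \<xi> k)"
        unfolding moment_def u_def scaleR_sum_right sum.distrib[symmetric]
        by (intro sum.cong) (auto simp: algebra_simps)
      then show ?thesis using md by simp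
    qed
    ultimately have "(\<Sum>k\<in>K. w k * ln (w k)) \<le> (\<Sum>k\<in>K. u k * ln (u k))" by (rule min)
    \<comment> \<open>The tangent at \<open>w + t d\<close>, evaluated at \<open>w\<close>;
      minimality of \<open>w\<close> then gives \<open>0 \<le> t * g t\<close>.\<close>
    moreover have "(\<Sum>k\<in>K. u k * ln (u k) + (- t * d k) * (ln (w k + t * d k) + 1))
        \<le> (\<Sum>k\<in>K. w k * ln (w k))"
    proof (rule sum_mono)
      fix k assume k: "k \<in> K"
      show "u k * ln (u k) + (- t * d k) * (ln (w k + t * d k) + 1) \<le> w k * ln (w k)"
        using alt[OF k t]
      proof
        assume "0 < w k + t * d k"
        from mult_ln_tangent[OF wD(2)[of k] this] show ?thesis
          unfolding u_def using k by (simp add: algebra_simps)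
      qed (auto simp: u_def)
    qed
    ultimately have "(\<Sum>k\<in>K. (- t * d k) * (ln (w k + t * d k) + 1)) \<le> 0"
      unfolding sum.distrib by linarith
    also have "(\<Sum>k\<in>K. (- t * d k) * (ln (w k + t * d k) + 1)) = - t * g t - t * sum d K"
      unfolding g_def sum_distrib_left sum_subtractf[symmetric]
      by (intro sum.cong) (auto simp: algebra_simps)
    finally have "0 \<le> t * g t" using sd by simp
    then show ?thesis using t by (simp add: zero_le_mult_iff)
  qed
  \<comment> \<open>Convexity again, term by term: each summand of \<open>g\<close> is nondecreasing
    in \<open>t\<close>.\<close>
  have mono: "d k * ln (w k + s * d k) \<le> d k * ln (w k + t * d k)"
    if "k \<in> K" "0 < s" "s \<le> t" "t < T" for k s t
  proof -
    have "0 < w k + s * d k \<or> d k = 0" using alt[of k s] that by auto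
    moreover have "0 < w k + t * d k \<or> d k = 0" using alt[of k t] that by auto
    moreover have "s * d k \<le> t * d k" if "0 \<le> d k" using that \<open>s \<le> t\<close> by (intro mult_right_mono) auto
    moreover have "t * d k \<le> s * d k" if "d k \<le> 0" using that \<open>s \<le> t\<close> by (intro mult_right_mono_neg) auto
    ultimately show ?thesis
      by (cases "d k = 0"; cases "0 \<le> d k") (auto intro!: mult_left_mono mult_left_mono_neg)
  qed
  have no: "d k = 0" if k: "k \<in> K" "w k = 0" for k
  proof (rule ccontr)
    assume "d k \<noteq> 0"
    then have dk: "0 < d k" using d0[OF k] by simp
    \<comment> \<open>By monotonicity \<open>C\<close> bounds the other summands of
      \<open>g t\<close> for \<open>t < T/2\<close>, whereas the summand of \<open>k\<close> tends
      to \<open>-\<infinity>\<close> as \<open>t\<close> decreases to 0. This contradicts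
      \<open>0 \<le> g t\<close>.\<close>
    define C where "C = (\<Sum>j\<in>K-{k}. d j * ln (w j + (T/2) * d j))"
    have "filterlim (\<lambda>t. d k * ln (t * d k)) at_bot (at_right 0)"
      using dk by real_asymp
    then have "\<forall>\<^sub>F t in at_right 0. d k * ln (t * d k) < - C"
      by (simp add: filterlim_at_bot_dense)
    moreover have "\<forall>\<^sub>F t in at_right 0. t < T/2" using T(1)
      by (intro eventually_at_right_less order_tendstoD(2)[OF tendsto_ident_at]) auto
    moreover have "\<forall>\<^sub>F t in at_right 0. (0::real) < t" by (rule eventually_at_right_less)
    ultimately have "\<forall>\<^sub>F t in at_right 0. d k * ln (t * d k) < - C \<and> t < T/2 \<and> 0 < t"
      by (intro eventually_conj)
    then obtain t where t: "d k * ln (t * d k) < - C" "t < T/2" "0 < t"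
      using eventually_happens'[of "at_right (0::real)"] by (auto simp: trivial_limit_at_right_real)
    have "g t = d k * ln (t * d k) + (\<Sum>j\<in>K-{k}. d j * ln (w j + t * d j))"
      unfolding g_def using K k by (simp add: sum.remove)
    also have "(\<Sum>j\<in>K-{k}. d j * ln (w j + t * d j)) \<le> C"
      unfolding C_def using t T(1) by (intro sum_mono mono) auto
    finally show False using g_nonneg[of t] t T(1) by simp
  qed
  \<comment> \<open>If \<open>w k = 0\<close>, then \<open>d k = 0\<close>, and
    \<open>\<alpha> k = \<beta> k > 0\<close> contradicts the support condition on
    \<open>\<alpha>\<close>.\<close>
  have supp': "0 < w k" if "k \<in> K" "0 < \<beta> k" for k
    using no[OF that(1)] wD(2)[of k] supp[OF that(1)] a[OF that(1)] that(2)
    unfolding d_def by (metis diff_0_right eq_iff_diff_eq_0 less_eq_real_def)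
  \<comment> \<open>The claim is the limit of \<open>0 \<le> g t\<close> as \<open>t\<close>
    decreases to 0; summands at vanishing weights are constantly 0.\<close>
  have "(g \<longlongrightarrow> (\<Sum>k\<in>K. d k * ln (w k))) (at_right 0)"
    unfolding g_def
  proof (rule tendsto_sum)
    fix k assume k: "k \<in> K"
    show "((\<lambda>t. d k * ln (w k + t * d k)) \<longlongrightarrow> d k * ln (w k)) (at_right 0)"
    proof (cases "w k = 0")
      case False
      have "((\<lambda>t. d k * ln (w k + t * d k)) \<longlongrightarrow> d k * ln (w k + 0 * d k)) (at_right 0)"
        using False by (intro tendsto_intros) auto
      then show ?thesis by simp
    qed (use no k in simp)
  qed
  moreover have "\<forall>\<^sub>F t in at_right 0. 0 \<le> g t"
    unfolding eventually_at_right_field using T(1) g_nonneg by blast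
  ultimately have "0 \<le> (\<Sum>k\<in>K. d k * ln (w k))"
    by (rule tendsto_lowerbound) (simp add: trivial_limit_at_right_real)
  then show ?thesis using supp' unfolding d_def by (auto simp: left_diff_distrib sum_subtractf)
qed

text \<open>Optimality in the directions \<open>\<beta> - \<alpha>\<close> and
  \<open>\<alpha> - \<beta>\<close> gives both inequalities between logarithms, provided one
  exponent is supported on the positive weights. Otherwise both monomials contain a zero
  factor.\<close>

lemma entropy_minimizer_in_toric_set:
  assumes K: "finite K" and w: "w \<in> weight_simplex K"
    and min: "\<And>u. u \<in> weight_simplex K \<Longrightarrow> moment \<xi> K u = moment \<xi> K w \<Longrightarrow>
        (\<Sum>k\<in>K. w k * ln (w k)) \<le> (\<Sum>k\<in>K. u k * ln (u k))"
  shows "w \<in> toric_set \<xi> K"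
  unfolding toric_set_def
proof (intro CollectI conjI w allI impI)
  fix \<alpha> \<beta> :: "'a \<Rightarrow> real"
  assume "\<forall>k\<in>K. 0 \<le> \<alpha> k" "\<forall>k\<in>K. 0 \<le> \<beta> k"
  then have a: "\<And>k. k \<in> K \<Longrightarrow> 0 \<le> \<alpha> k" and b: "\<And>k. k \<in> K \<Longrightarrow> 0 \<le> \<beta> k" by auto
  assume eq: "sum \<alpha> K = sum \<beta> K" "moment \<xi> K \<alpha> = moment \<xi> K \<beta>"
  note ab = entropy_minimizer_direction[OF K w min a b eq]
    and ba = entropy_minimizer_direction[OF K w min b a eq[symmetric]]
  show "monomial K \<alpha> w = monomial K \<beta> w"
  proof (cases "(\<forall>k\<in>K. 0 < \<alpha> k \<longrightarrow> 0 < w k) \<or> (\<forall>k\<in>K. 0 < \<beta> k \<longrightarrow> 0 < w k)")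
    case True
    then have supp: "0 < w k" if "k \<in> K" "0 < \<alpha> k \<or> 0 < \<beta> k" for k
      using ab ba that by blast
    have "(\<Sum>k\<in>K. \<alpha> k * ln (w k)) \<le> (\<Sum>k\<in>K. \<beta> k * ln (w k))"
      by (rule ab[THEN conjunct2]) (auto intro: supp)
    moreover have "(\<Sum>k\<in>K. \<beta> k * ln (w k)) \<le> (\<Sum>k\<in>K. \<alpha> k * ln (w k))"
      by (rule ba[THEN conjunct2]) (auto intro: supp)
    ultimately have "(\<Sum>k\<in>K. \<alpha> k * ln (w k)) = (\<Sum>k\<in>K. \<beta> k * ln (w k))"
      by linarith
    then show ?thesis using supp K a b by (simp add: monomial_eq_exp)
  next
    case False
    then obtain j k where "j \<in> K" "0 < \<alpha> j" "w j = 0" "k \<in> K" "0 < \<beta> k" "w k = 0"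
      using weight_simplexD(2)[OF w] by (auto simp: less_le)
    then have "monomial K \<alpha> w = 0" "monomial K \<beta> w = 0" using K by (auto intro: monomial_eq_0)
    then show ?thesis by simp
  qed
qed

text \<open>The fibre of the moment map through \<open>v\<close> is compact, so the continuous
  negative entropy attains a minimum on it.\<close>

lemma moment_image_toric_set:
  assumes K: "finite K"
  shows "moment \<xi> K ` toric_set \<xi> K = moment \<xi> K ` weight_simplex K"
proof
  show "moment \<xi> K ` weight_simplex K \<subseteq> moment \<xi> K ` toric_set \<xi> K"
  proof (rule image_subsetI)
    fix v assume v: "v \<in> weight_simplex K"
    define S where "S = weight_simplex K \<inter> moment \<xi> K -` {moment \<xi> K v}"
    have "closedin (top_of_set (weight_simplex K)) S"
      unfolding S_def by (intro continuous_closedin_preimage continuous_on_moment) auto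
    then have "compact S" using compact_weight_simplex[OF K] closedin_compact by blast
    moreover have "S \<noteq> {}" using v unfolding S_def by auto
    moreover have "continuous_on S (\<lambda>w. \<Sum>k\<in>K. w k * ln (w k))"
    proof (rule continuous_on_sum)
      fix k
      show "continuous_on S (\<lambda>w. w k * ln (w k))"
        by (rule continuous_on_compose2[OF continuous_on_mult_ln
              continuous_on_subset[OF continuous_on_product_coordinates]])
          (auto simp: S_def weight_simplexD(2))
    qed
    ultimately obtain w where w: "w \<in> S"
      "\<And>u. u \<in> S \<Longrightarrow> (\<Sum>k\<in>K. w k * ln (w k)) \<le> (\<Sum>k\<in>K. u k * ln (u k))"
      using continuous_attains_inf[of S "\<lambda>w. \<Sum>k\<in>K. w k * ln (w k)"] by auto
    then have "w \<in> toric_set \<xi> K"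
      by (intro entropy_minimizer_in_toric_set[OF K]) (auto simp: S_def)
    moreover have "moment \<xi> K w = moment \<xi> K v" using w unfolding S_def by simp
    ultimately show "moment \<xi> K v \<in> moment \<xi> K ` toric_set \<xi> K" by (intro image_eqI[of _ _ w]) auto
  qed
qed (use toric_set_subset_simplex in blast)

lemma moment_image_weight_simplex:
  assumes K: "finite K"
  shows "moment \<xi> K ` weight_simplex K = convex hull (\<xi> ` K)"
proof
  show "moment \<xi> K ` weight_simplex K \<subseteq> convex hull (\<xi> ` K)"
    unfolding moment_def
    by (rule image_subsetI, rule convex_sum[OF K convex_convex_hull])
      (auto simp: weight_simplexD intro: hull_inc)
  have "\<xi> ` K \<subseteq> moment \<xi> K ` weight_simplex K"
  proof (rule image_subsetI)
    fix k assume k: "k \<in> K"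
    have "(\<lambda>j. if j = k then 1 else 0) \<in> weight_simplex K" unfolding weight_simplex_def using k K by auto
    moreover have "moment \<xi> K (\<lambda>j. if j = k then 1 else 0) = \<xi> k" unfolding moment_def using k K
      by (simp add: if_distrib[of "\<lambda>c. c *\<^sub>R _"] cong: if_cong)
    ultimately show "\<xi> k \<in> moment \<xi> K ` weight_simplex K" by (metis imageI)
  qed
  moreover have "convex (moment \<xi> K ` weight_simplex K)"
    unfolding convex_alt
  proof clarify
    fix v w and t :: real assume v: "v \<in> weight_simplex K" and w: "w \<in> weight_simplex K" and t: "0 \<le> t" "t \<le> 1"
    have "(\<lambda>k. (1 - t) * v k + t * w k) \<in> weight_simplex K"
      using v w t unfolding weight_simplex_def
      by (auto simp: sum.distrib sum_distrib_left[symmetric])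
    moreover have "moment \<xi> K (\<lambda>k. (1 - t) * v k + t * w k) = (1 - t) *\<^sub>R moment \<xi> K v + t *\<^sub>R moment \<xi> K w"
      unfolding moment_def scaleR_sum_right sum.distrib[symmetric] by (simp add: algebra_simps)
    ultimately show "(1 - t) *\<^sub>R moment \<xi> K v + t *\<^sub>R moment \<xi> K w \<in> moment \<xi> K ` weight_simplex K"
      by (intro image_eqI[of _ _ "\<lambda>k. (1 - t) * v k + t * w k"]) auto
  qed
  ultimately show "convex hull (\<xi> ` K) \<subseteq> moment \<xi> K ` weight_simplex K" by (rule hull_minimal)
qed

section \<open>Relative interiors in the dual space\<close>

text \<open>The vector representing a functional. It moves questions about the dual into the
  Euclidean space \<open>'a\<close>, where inner products and the theory of convex polytopes
  apply.\<close>

definition riesz :: "('a::euclidean_space \<Rightarrow>\<^sub>L real) \<Rightarrow> 'a" where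
  "riesz \<zeta> = (\<Sum>b\<in>Basis. blinfun_apply \<zeta> b *\<^sub>R b)"

lemma riesz_inner: "riesz \<zeta> \<bullet> v = blinfun_apply \<zeta> v"
proof -
  have "blinfun_apply \<zeta> v = blinfun_apply \<zeta> (\<Sum>b\<in>Basis. (v \<bullet> b) *\<^sub>R b)"
    by (simp add: euclidean_representation)
  also have "\<dots> = riesz \<zeta> \<bullet> v"
    by (simp add: riesz_def blinfun.sum_right blinfun.scaleR_right inner_sum_left)
      (simp add: inner_commute mult.commute)
  finally show ?thesis by simp
qed

lemma blinfun_inner_right_riesz: "blinfun_inner_right (riesz \<zeta>) = \<zeta>"
  by (rule blinfun_eqI) (simp add: riesz_inner)

lemma riesz_blinfun_inner_right: "riesz (blinfun_inner_right x) = x"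
  by (simp add: riesz_def euclidean_representation)

lemma bounded_linear_riesz: "bounded_linear riesz"
  unfolding riesz_def
  by (rule bounded_linear_sum, rule bounded_linear_scaleR_const, rule blinfun.bounded_linear_left)

lemma riesz_eq_iff: "riesz \<zeta> = riesz \<eta> \<longleftrightarrow> \<zeta> = \<eta>"
  by (metis blinfun_inner_right_riesz)

lemma riesz_moment: "riesz (moment \<xi> K w) = moment (\<lambda>k. riesz (\<xi> k)) K w"
proof -
  interpret bounded_linear riesz by (rule bounded_linear_riesz)
  show ?thesis unfolding moment_def by (simp add: sum scaleR)
qed

text \<open>If the open set \<open>U\<close> witnesses a point of the relative interior, its
  preimage under the continuous left inverse \<open>g\<close> is open and witnesses the image
  point.\<close>

lemma rel_interior_linear_image_subset:
  assumes f: "bounded_linear f" and g: "bounded_linear g" and gf: "\<And>x. g (f x) = x"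
  shows "f ` rel_interior S \<subseteq> rel_interior (f ` S)"
proof (rule image_subsetI)
  fix x assume "x \<in> rel_interior S"
  then obtain U where U: "open U" "x \<in> affine hull S \<inter> U" "affine hull S \<inter> U \<subseteq> S"
    unfolding rel_interior_def openin_open by auto
  have "open (g -` U)"
    using U(1) linear_continuous_on[OF g] by (simp add: continuous_on_open_vimage open_vimage)
  moreover have "affine hull (f ` S) = f ` (affine hull S)"
    by (simp add: affine_hull_linear_image[OF f])
  moreover have "f ` (affine hull S) \<inter> g -` U = f ` (affine hull S \<inter> U)"
    using gf by auto
  ultimately have "openin (top_of_set (affine hull (f ` S))) (f ` (affine hull S \<inter> U))"
    unfolding openin_open by metis
  moreover have "f x \<in> f ` (affine hull S \<inter> U)" "f ` (affine hull S \<inter> U) \<subseteq> f ` S"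
    using U by blast+
  ultimately show "f x \<in> rel_interior (f ` S)"
    unfolding rel_interior_def by blast
qed

text \<open>Singletons are their own relative interiors, so the description of the relative interior
  of the hull of finitely many convex sets yields strictly positive coefficients.\<close>

lemma rel_interior_convex_hull_image:
  fixes r :: "'i \<Rightarrow> 'a::euclidean_space"
  assumes "finite L"
  shows "rel_interior (convex hull (r ` L)) = {moment r L c | c. (\<forall>k\<in>L. 0 < c k) \<and> sum c L = 1}"
proof -
  have "r ` L = \<Union> ((\<lambda>k. {r k}) ` L)" by auto
  then have "rel_interior (convex hull (r ` L)) =
    {sum (\<lambda>i. c i *\<^sub>R s i) L | c s. (\<forall>i\<in>L. c i > 0) \<and> sum c L = 1 \<and> (\<forall>i\<in>L. s i \<in> rel_interior {r i})}"
    using rel_interior_convex_hull_union[OF assms, of "\<lambda>k. {r k}"] by simp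
  also have "\<dots> = {moment r L c | c. (\<forall>k\<in>L. 0 < c k) \<and> sum c L = 1}"
    unfolding moment_def by (auto intro!: exI[of _ r] sum.cong)
  finally show ?thesis .
qed

text \<open>\<open>riesz\<close> and \<open>blinfun_inner_right\<close> are mutually inverse, so the
  inclusion for linear images, used in both directions, transports the Euclidean description to the
  dual.\<close>

lemma open_face_eq:
  assumes L: "finite L"
  shows "open_face \<xi> L = {moment \<xi> L c | c. (\<forall>k\<in>L. 0 < c k) \<and> sum c L = 1}"
proof -
  let ?r = "\<lambda>k. riesz (\<xi> k)"
  let ?P = "convex hull (\<xi> ` L)"
  have im: "riesz ` ?P = convex hull (?r ` L)"
    using convex_hull_linear_image[OF bounded_linear.linear[OF bounded_linear_riesz], of "\<xi> ` L"]
    by (simp add: image_image)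
  then have im': "blinfun_inner_right ` (convex hull (?r ` L)) = ?P"
    by (simp add: im[symmetric] image_image blinfun_inner_right_riesz)
  have sub1: "riesz ` rel_interior ?P \<subseteq> rel_interior (convex hull (?r ` L))"
    unfolding im[symmetric]
    by (rule rel_interior_linear_image_subset[OF bounded_linear_riesz bounded_linear_blinfun_inner_right])
      (rule blinfun_inner_right_riesz)
  have sub2: "blinfun_inner_right ` rel_interior (convex hull (?r ` L)) \<subseteq> rel_interior ?P"
    unfolding im'[symmetric]
    by (rule rel_interior_linear_image_subset[OF bounded_linear_blinfun_inner_right bounded_linear_riesz])
      (rule riesz_blinfun_inner_right)
  have iff: "\<zeta> \<in> rel_interior ?P \<longleftrightarrow> riesz \<zeta> \<in> rel_interior (convex hull (?r ` L))" for \<zeta>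
  proof
    show "\<zeta> \<in> rel_interior ?P" if "riesz \<zeta> \<in> rel_interior (convex hull (?r ` L))"
      using sub2 imageI[OF that, of blinfun_inner_right] by (auto simp: blinfun_inner_right_riesz)
  qed (use sub1 in blast)
  show ?thesis
    unfolding open_face_def closed_face_def set_eq_iff iff rel_interior_convex_hull_image[OF L]
      riesz_moment[symmetric] mem_Collect_eq riesz_eq_iff by simp
qed

section \<open>Faces of the dual polyhedron\<close>

definition softmax :: "(nat \<Rightarrow> 'a::euclidean_space \<Rightarrow>\<^sub>L real) \<Rightarrow> nat set \<Rightarrow> 'a \<Rightarrow> nat \<Rightarrow> real" where
  "softmax \<xi> L p k = (if k \<in> L then exp (blinfun_apply (\<xi> k) p) / b_val \<xi> L p else 0)"

lemma b_val_pos: "finite L \<Longrightarrow> L \<noteq> {} \<Longrightarrow> 0 < b_val \<xi> L p"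
  unfolding b_val_def by (intro sum_pos) auto

lemma softmax_pos_iff:
  "finite L \<Longrightarrow> 0 < softmax \<xi> L p k \<longleftrightarrow> k \<in> L"
  using b_val_pos[of L \<xi> p] unfolding softmax_def by (cases "L = {}") auto

lemma sum_softmax:
  assumes "finite L" "L \<noteq> {}"
  shows "sum (softmax \<xi> L p) L = 1"
  using b_val_pos[OF assms, of \<xi> p]
  by (simp add: softmax_def sum_divide_distrib[symmetric] b_val_def)

lemma moment_softmax:
  shows "moment \<xi> L (softmax \<xi> L p) = c_vec \<xi> L p"
  by (simp add: moment_def softmax_def c_vec_def a_vec_def scaleR_sum_right divide_inverse mult.commute)

lemma moment_superset:
  assumes "finite K" "L \<subseteq> K" "\<And>k. k \<in> K - L \<Longrightarrow> w k = 0"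
  shows "moment \<xi> K w = moment \<xi> L w"
  unfolding moment_def using assms by (intro sum.mono_neutral_right) auto

lemma stratum_proj_eqI:
  assumes "L = K \<Longrightarrow> p = q" "p - q \<in> eq_subspace \<xi> L"
  shows "stratum_proj \<xi> K L p = stratum_proj \<xi> K L q"
proof -
  have "eq_coset \<xi> L p = eq_coset \<xi> L q"
  proof -
    have *: "eq_coset \<xi> L p \<subseteq> eq_coset \<xi> L q" if pq: "p - q \<in> eq_subspace \<xi> L" for p q
    proof
      fix x assume "x \<in> eq_coset \<xi> L p"
      then obtain h where h: "x = p + h" "h \<in> eq_subspace \<xi> L" unfolding eq_coset_def by blast
      have "blinfun_apply (\<xi> k) (p - q) + blinfun_apply (\<xi> k) h =
          blinfun_apply (\<xi> l) (p - q) + blinfun_apply (\<xi> l) h" if "k \<in> L" "l \<in> L" for k l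
        using pq h(2) that unfolding eq_subspace_def by (metis (mono_tags, lifting) mem_Collect_eq)
      then have "(p - q) + h \<in> eq_subspace \<xi> L"
        unfolding eq_subspace_def mem_Collect_eq blinfun.add_right by blast
      then show "x \<in> eq_coset \<xi> L q" unfolding eq_coset_def h(1)
        by (intro image_eqI[of _ _ "(p - q) + h"]) auto
    qed
    have "- (p - q) \<in> eq_subspace \<xi> L"
      using assms(2) unfolding eq_subspace_def mem_Collect_eq blinfun.minus_right by (metis (no_types))
    then have "q - p \<in> eq_subspace \<xi> L" by simp
    then show ?thesis using *[of p q] *[of q p] assms(2) by auto
  qed
  then show ?thesis using assms(1) by (auto simp: stratum_proj_def)
qed

text \<open>The facts about facet functionals on which the argument rests: \<open>definite\<close>
  encodes boundedness of the polyhedron, and \<open>vertex\<close> says that each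
  \<open>\<xi> k\<close> is an exposed vertex of the dual polyhedron, distinct from the other
  functionals.\<close>

locale polyhedral_norm =
  fixes K :: "nat set" and \<xi> :: "nat \<Rightarrow> 'a::euclidean_space \<Rightarrow>\<^sub>L real"
  assumes fin: "finite K"
    and definite: "(\<And>k. k \<in> K \<Longrightarrow> blinfun_apply (\<xi> k) u \<le> 0) \<Longrightarrow> u = 0"
    and vertex: "k \<in> K \<Longrightarrow> \<exists>v. blinfun_apply (\<xi> k) v = 1 \<and> (\<forall>j\<in>K - {k}. blinfun_apply (\<xi> j) v < 1)"
begin

abbreviation "faces \<equiv> dual_faces \<xi> K \<union> {K}"

lemma K_nonempty: "K \<noteq> {}"
  using definite[of "SOME b. b \<in> Basis"] by (metis SOME_Basis empty_iff nonzero_Basis)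

lemma exists_pos: "u \<noteq> 0 \<Longrightarrow> \<exists>k\<in>K. 0 < blinfun_apply (\<xi> k) u"
  using definite[of u] by (meson not_le)

lemma inj_on_functionals: "inj_on \<xi> K"
proof (rule inj_onI, rule ccontr)
  fix j k assume "j \<in> K" "k \<in> K" "\<xi> j = \<xi> k" "j \<noteq> k"
  then show False using vertex[of k] by (metis DiffI less_irrefl singletonD)
qed

lemma faceD:
  assumes "L \<in> faces"
  shows "L \<subseteq> K" "L \<noteq> {}" "finite L"
  using assms K_nonempty fin by (auto simp: dual_faces_def dest: finite_subset)

lemma partial_norm_eq_1_iff:
  "partial_norm \<xi> K v = 1 \<longleftrightarrow>
    (\<forall>k\<in>K. blinfun_apply (\<xi> k) v \<le> 1) \<and> (\<exists>k\<in>K. blinfun_apply (\<xi> k) v = 1)"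
  unfolding partial_norm_def using fin K_nonempty by (subst Max_eq_iff) (auto simp: image_iff)

lemma face_normal:
  assumes "L \<in> faces" "L \<noteq> K"
  obtains v where "\<And>k. k \<in> L \<Longrightarrow> blinfun_apply (\<xi> k) v = 1"
    "\<And>k. k \<in> K - L \<Longrightarrow> blinfun_apply (\<xi> k) v < 1"
proof -
  from assms obtain v where v: "partial_norm \<xi> K v = 1" "L = {k \<in> K. blinfun_apply (\<xi> k) v = 1}"
    by (auto simp: dual_faces_def)
  have "blinfun_apply (\<xi> k) v < 1" if "k \<in> K - L" for k
    using v partial_norm_eq_1_iff[of v] that by fastforce
  then show thesis using v(2) by (intro that[of v]) auto
qed

text \<open>For a normal \<open>v\<close> of the face, the sum of
  \<open>\<gamma> k * (1 - \<xi> k v)\<close> depends only on the mass and moment of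
  \<open>\<gamma>\<close>. It vanishes for \<open>\<alpha>\<close>, and for \<open>\<beta>\<close>
  its terms are nonnegative, and positive wherever \<open>\<beta>\<close> charges an index off
  \<open>L\<close>.\<close>

lemma support_subset_face:
  assumes L: "L \<in> faces"
    and a: "\<And>k. k \<in> K \<Longrightarrow> 0 \<le> \<alpha> k" and b: "\<And>k. k \<in> K \<Longrightarrow> 0 \<le> \<beta> k"
    and eq: "sum \<alpha> K = sum \<beta> K" "moment \<xi> K \<alpha> = moment \<xi> K \<beta>"
    and supp: "\<And>k. k \<in> K \<Longrightarrow> 0 < \<alpha> k \<Longrightarrow> k \<in> L" and k: "k \<in> K" "0 < \<beta> k"
  shows "k \<in> L"
proof (cases "L = K")
  case False
  obtain v where v: "\<And>k. k \<in> L \<Longrightarrow> blinfun_apply (\<xi> k) v = 1"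
    "\<And>k. k \<in> K - L \<Longrightarrow> blinfun_apply (\<xi> k) v < 1"
    using face_normal[OF L False] by metis
  have "(\<Sum>k\<in>K. \<gamma> k * (1 - blinfun_apply (\<xi> k) v)) = sum \<gamma> K - blinfun_apply (moment \<xi> K \<gamma>) v" for \<gamma>
    by (simp add: moment_blinfun_apply algebra_simps sum_subtractf)
  then have "(\<Sum>k\<in>K. \<beta> k * (1 - blinfun_apply (\<xi> k) v)) = (\<Sum>k\<in>K. \<alpha> k * (1 - blinfun_apply (\<xi> k) v))"
    using eq by simp
  also have "\<dots> = 0"
  proof (rule sum.neutral, rule ballI)
    fix j assume "j \<in> K"
    then show "\<alpha> j * (1 - blinfun_apply (\<xi> j) v) = 0"
      using supp[of j] a[of j] v(1)[of j] by (cases "0 < \<alpha> j") auto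
  qed
  finally have z: "(\<Sum>k\<in>K. \<beta> k * (1 - blinfun_apply (\<xi> k) v)) = 0" .
  have nn: "0 \<le> \<beta> j * (1 - blinfun_apply (\<xi> j) v)" if "j \<in> K" for j
    using b[OF that] v(1)[of j] v(2)[of j] that by (cases "j \<in> L") auto
  have "\<beta> k * (1 - blinfun_apply (\<xi> k) v) = 0"
    using sum_nonneg_eq_0_iff[OF fin nn] z k(1) by simp
  then show ?thesis using k v(2)[of k] by auto
qed (use k in simp)

lemma softmax_in_simplex:
  assumes L: "L \<in> faces"
  shows "softmax \<xi> L p \<in> weight_simplex K"
proof -
  have "sum (softmax \<xi> L p) K = sum (softmax \<xi> L p) L"
    using faceD[OF L] fin by (intro sum.mono_neutral_right) (auto simp: softmax_def)
  moreover have "0 \<le> softmax \<xi> L p k" for k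
    using b_val_pos[of L \<xi> p] faceD[OF L] by (simp add: softmax_def)
  ultimately show ?thesis
    using sum_softmax[of L] faceD[OF L] unfolding weight_simplex_def by (auto simp: softmax_def)
qed

text \<open>If the exponents live on \<open>L\<close>, the monomial is a function of mass and moment
  alone. By \<open>support_subset_face\<close> one exponent lives on \<open>L\<close> exactly if the
  other does; in the remaining case both monomials vanish.\<close>

lemma softmax_in_toric_set:
  assumes L: "L \<in> faces"
  shows "softmax \<xi> L p \<in> toric_set \<xi> K"
  unfolding toric_set_def
proof (intro CollectI conjI allI impI softmax_in_simplex[OF L])
  fix \<alpha> \<beta> :: "nat \<Rightarrow> real"
  assume "\<forall>k\<in>K. 0 \<le> \<alpha> k" "\<forall>k\<in>K. 0 \<le> \<beta> k"
  then have a: "\<And>k. k \<in> K \<Longrightarrow> 0 \<le> \<alpha> k" and b: "\<And>k. k \<in> K \<Longrightarrow> 0 \<le> \<beta> k" by auto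
  assume eq: "sum \<alpha> K = sum \<beta> K" "moment \<xi> K \<alpha> = moment \<xi> K \<beta>"
  let ?w = "softmax \<xi> L p"
  note fL = faceD[OF L]
  have pos: "0 < ?w k \<longleftrightarrow> k \<in> L" for k by (rule softmax_pos_iff[OF fL(3)])
  have b0: "0 < b_val \<xi> L p" using fL by (intro b_val_pos)
  have val: "monomial K \<gamma> ?w = exp (blinfun_apply (moment \<xi> K \<gamma>) p - sum \<gamma> K * ln (b_val \<xi> L p))"
    if nn: "\<And>k. k \<in> K \<Longrightarrow> 0 \<le> \<gamma> k" and supp: "\<And>k. k \<in> K \<Longrightarrow> 0 < \<gamma> k \<Longrightarrow> k \<in> L" for \<gamma>
  proof -
    have "monomial K \<gamma> ?w = exp (\<Sum>k\<in>K. \<gamma> k * ln (?w k))"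
      using fin nn supp pos by (intro monomial_eq_exp) auto
    also have "(\<Sum>k\<in>K. \<gamma> k * ln (?w k)) = (\<Sum>k\<in>K. \<gamma> k * (blinfun_apply (\<xi> k) p - ln (b_val \<xi> L p)))"
    proof (rule sum.cong)
      fix k assume k: "k \<in> K"
      show "\<gamma> k * ln (?w k) = \<gamma> k * (blinfun_apply (\<xi> k) p - ln (b_val \<xi> L p))"
      proof (cases "k \<in> L")
        case True
        then show ?thesis using b0 by (simp add: softmax_def ln_div)
      next
        case False
        then have "\<gamma> k = 0" using nn[OF k] supp[OF k] by fastforce
        then show ?thesis by simp
      qed
    qed simp
    also have "\<dots> = blinfun_apply (moment \<xi> K \<gamma>) p - sum \<gamma> K * ln (b_val \<xi> L p)"
      by (simp add: moment_blinfun_apply algebra_simps sum_subtractf sum_distrib_left sum_distrib_right)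
    finally show ?thesis .
  qed
  show "monomial K \<alpha> ?w = monomial K \<beta> ?w"
  proof (cases "(\<forall>k\<in>K. 0 < \<alpha> k \<longrightarrow> k \<in> L) \<or> (\<forall>k\<in>K. 0 < \<beta> k \<longrightarrow> k \<in> L)")
    case True
    then have "(\<forall>k\<in>K. 0 < \<alpha> k \<longrightarrow> k \<in> L)" "(\<forall>k\<in>K. 0 < \<beta> k \<longrightarrow> k \<in> L)"
      using support_subset_face[OF L a b eq] support_subset_face[OF L b a eq[symmetric]] by blast+
    then show ?thesis using val[OF a] val[OF b] eq by simp
  next
    case False
    then obtain j k where "j \<in> K" "0 < \<alpha> j" "?w j = 0" "k \<in> K" "0 < \<beta> k" "?w k = 0"
      by (auto simp: softmax_def)
    then have "monomial K \<alpha> ?w = 0" "monomial K \<beta> ?w = 0"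
      using fin by (auto intro: monomial_eq_0)
    then show ?thesis by simp
  qed
qed

lemma moment_softmax_face:
  assumes L: "L \<in> faces"
  shows "moment \<xi> K (softmax \<xi> L p) = c_vec \<xi> L p"
  using moment_superset[of K L "softmax \<xi> L p" \<xi>] faceD[OF L] fin moment_softmax[of \<xi> L p]
  by (simp add: softmax_def)

lemma softmax_eqD:
  assumes L: "L \<in> faces" and M: "M \<in> faces" and eq: "softmax \<xi> L p = softmax \<xi> M q"
  shows "L = M" "stratum_proj \<xi> K L p = stratum_proj \<xi> K M q"
proof -
  note fL = faceD[OF L]
  show LM: "L = M"
    using softmax_pos_iff[OF fL(3), of \<xi> p] softmax_pos_iff[OF faceD(3)[OF M], of \<xi> q]
    unfolding eq by blast
  have b: "0 < b_val \<xi> L p" "0 < b_val \<xi> L q" using fL by (auto intro: b_val_pos)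
  have diff: "blinfun_apply (\<xi> k) (p - q) = ln (b_val \<xi> L p) - ln (b_val \<xi> L q)" if "k \<in> L" for k
  proof -
    have "ln (softmax \<xi> L p k) = ln (softmax \<xi> L q k)" using eq LM by simp
    then show ?thesis using that b by (simp add: softmax_def ln_div blinfun.diff_right)
  qed
  \<comment> \<open>On \<open>K\<close> all functionals take a common value at \<open>p - q\<close>;
    according to its sign, \<open>definite\<close> applies to \<open>p - q\<close> or to
    \<open>q - p\<close>.\<close>
  have "p = q" if "L = K"
  proof -
    have "p - q = 0 \<or> q - p = 0"
    proof (cases "ln (b_val \<xi> L p) - ln (b_val \<xi> L q) \<le> 0")
      case True
      then have "p - q = 0" using diff that by (intro definite) simp
      then show ?thesis ..
    next
      case False
      have "blinfun_apply (\<xi> k) (q - p) = - blinfun_apply (\<xi> k) (p - q)" for k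
        by (simp add: blinfun.diff_right)
      then have "q - p = 0" using diff that False by (intro definite) simp
      then show ?thesis ..
    qed
    then show ?thesis by auto
  qed
  then show "stratum_proj \<xi> K L p = stratum_proj \<xi> K M q"
    unfolding LM using diff by (intro stratum_proj_eqI) (auto simp: LM eq_subspace_def)
qed

text \<open>By \<open>toric_set_support_signed\<close>, no affine relation is positive only on the
  support \<open>L\<close> and negative somewhere off it. Hence the affine hull of the vertices in
  \<open>L\<close> misses the convex hull of the others, so the vertices in \<open>L\<close> span an
  exposed face. Rescaling its supporting hyperplane to level 1 gives the normal required of a dual
  face.\<close>

lemma toric_set_support_face:
  assumes w: "w \<in> toric_set \<xi> K"
  shows "{k\<in>K. 0 < w k} \<in> faces"
proof (cases "{k\<in>K. 0 < w k} = K")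
  case False
  define L where "L = {k\<in>K. 0 < w k}"
  define r where "r k = riesz (\<xi> k)" for k
  have LK: "L \<subseteq> K" "L \<noteq> K" using False unfolding L_def by auto
  have "w \<in> weight_simplex K" using w toric_set_subset_simplex by blast
  note wD = weight_simplexD[OF this]
  have Lne: "L \<noteq> {}"
  proof
    assume "L = {}"
    then have "w k = 0" if "k \<in> K" for k using wD(2)[of k] that unfolding L_def by fastforce
    then show False using wD(3) by simp
  qed
  have inj: "inj_on r K" using inj_on_functionals by (simp add: inj_on_def r_def riesz_eq_iff)
  have outside: "\<not> d k < 0"
    if "sum d K = 0" "(\<Sum>k\<in>K. d k *\<^sub>R r k) = 0" "\<And>k. k \<in> K - L \<Longrightarrow> d k \<le> 0" "k \<in> K - L" for d k
  proof
    assume "d k < 0"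
    have "riesz (moment \<xi> K d) = riesz 0"
      using that(2) unfolding riesz_moment by (simp add: moment_def r_def riesz_def)
    then have "moment \<xi> K d = 0" by (simp add: riesz_eq_iff)
    moreover have "0 < w j" if "j \<in> K" "0 < d j" for j
    proof (cases "j \<in> L")
      case False
      then have "d j \<le> 0" using \<open>\<And>k. k \<in> K - L \<Longrightarrow> d k \<le> 0\<close>[of j] that(1) by blast
      then show ?thesis using that(2) by simp
    qed (simp add: L_def)
    ultimately have "0 < w k" using that(4) \<open>d k < 0\<close>
      by - (rule toric_set_support_signed[OF fin w that(1)], auto)
    then show False using that(4) unfolding L_def by simp
  qed
  have img: "r ` K - r ` L = r ` (K - L)" using inj LK by (simp add: inj_on_image_set_diff)
  have injL: "inj_on r L" "inj_on r (K - L)" using inj LK by (auto intro: inj_on_subset)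
  have finL: "finite L" "finite (K - L)" using fin LK finite_subset by auto
  have disj: "affine hull (r ` L) \<inter> convex hull (r ` K - r ` L) = {}"
  proof (rule ccontr)
    assume "\<not> ?thesis"
    then obtain x where x: "x \<in> affine hull (r ` L)" "x \<in> convex hull (r ` (K - L))"
      unfolding img by blast
    obtain u where u: "sum u (r ` L) = 1" "(\<Sum>x\<in>r ` L. u x *\<^sub>R x) = x"
      using x(1) unfolding affine_hull_finite[OF finite_imageI[OF finL(1)]] by blast
    obtain v where v: "\<forall>x\<in>r ` (K - L). 0 \<le> v x" "sum v (r ` (K - L)) = 1"
      "(\<Sum>x\<in>r ` (K - L). v x *\<^sub>R x) = x"
      using x(2) unfolding convex_hull_finite[OF finite_imageI[OF finL(2)]] by blast
    \<comment> \<open>An affine combination minus a convex combination of the same point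
      \<open>x\<close>: a relation that can be positive only on \<open>L\<close>.\<close>
    define d where "d k = (if k \<in> L then u (r k) else - v (r k))" for k
    have split: "sum f K = sum f L + sum f (K - L)" for f :: "nat \<Rightarrow> 'c::comm_monoid_add"
      using sum.subset_diff[OF LK(1) fin, of f] by (simp add: add.commute)
    have "sum d K = 0"
      using u v unfolding split d_def using injL by (simp add: sum.reindex sum_negf)
    moreover have "(\<Sum>k\<in>K. d k *\<^sub>R r k) = 0"
      using u v unfolding split d_def using injL by (simp add: sum.reindex sum_negf)
    moreover have "d k \<le> 0" if "k \<in> K - L" for k using v(1) that by (simp add: d_def)
    ultimately have "\<not> d k < 0" if "k \<in> K - L" for k using outside that by blast
    then have "v x = 0" if "x \<in> r ` (K - L)" for x using that v(1) unfolding d_def by force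
    then show False using v(2) by simp
  qed
  have "convex hull (r ` L) face_of convex hull (r ` K)"
    using fin LK disj by (intro face_of_convex_hulls) auto
  then have "convex hull (r ` L) exposed_face_of convex hull (r ` K)"
    using fin by (simp add: exposed_face_of_polyhedron polyhedron_convex_hull)
  then obtain a b where ab: "convex hull (r ` K) \<subseteq> {x. a \<bullet> x \<le> b}"
    "convex hull (r ` L) = convex hull (r ` K) \<inter> {x. a \<bullet> x = b}"
    unfolding exposed_face_of_def by blast
  have rK: "r k \<in> convex hull (r ` K)" if "k \<in> K" for k using that by (simp add: hull_inc)
  have le: "r k \<bullet> a \<le> b" if "k \<in> K" for k using ab(1) rK[OF that] by (auto simp: inner_commute)
  have iff: "r k \<bullet> a = b \<longleftrightarrow> k \<in> L" if k: "k \<in> K" for k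
  proof
    assume "k \<in> L"
    then have "r k \<in> convex hull (r ` L)" by (simp add: hull_inc)
    then show "r k \<bullet> a = b" unfolding ab(2) by (simp add: inner_commute)
  next
    assume "r k \<bullet> a = b"
    then have "r k \<in> convex hull (r ` L)" unfolding ab(2) using rK[OF k] by (simp add: inner_commute)
    then have "r k \<in> affine hull (r ` L)" using convex_hull_subset_affine_hull by blast
    then have "r k \<notin> convex hull (r ` (K - L))" using disj unfolding img by blast
    then show "k \<in> L" using k by (meson DiffI hull_inc imageI)
  qed
  have "a \<noteq> 0"
  proof
    assume "a = 0"
    obtain k where "k \<in> L" using Lne by blast
    then have "b = 0" using iff[of k] LK \<open>a = 0\<close> by auto
    then have "K \<subseteq> L" using iff \<open>a = 0\<close> by auto
    then show False using LK by blast
  qed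
  \<comment> \<open>Some functional is positive at \<open>a\<close>, so the level \<open>b\<close>
    above it is positive and can be scaled to 1.\<close>
  then obtain k where "k \<in> K" "0 < r k \<bullet> a" using exists_pos[of a] by (auto simp: r_def riesz_inner)
  then have b: "0 < b" using le[of k] by simp
  have app: "blinfun_apply (\<xi> k) (a /\<^sub>R b) = (r k \<bullet> a) / b" for k
    by (simp add: r_def riesz_inner blinfun.scaleR_right divide_inverse mult.commute)
  have "blinfun_apply (\<xi> k) (a /\<^sub>R b) \<le> 1" if "k \<in> K" for k using le[OF that] b by (simp add: app)
  moreover have one: "blinfun_apply (\<xi> k) (a /\<^sub>R b) = 1 \<longleftrightarrow> k \<in> L" if "k \<in> K" for k
    using iff[OF that] b by (auto simp: app)
  ultimately have "partial_norm \<xi> K (a /\<^sub>R b) = 1"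
    unfolding partial_norm_eq_1_iff using Lne LK by blast
  moreover have "L = {k\<in>K. blinfun_apply (\<xi> k) (a /\<^sub>R b) = 1}" using one LK by blast
  ultimately have "L \<in> dual_faces \<xi> K" unfolding dual_faces_def using LK Lne by blast
  then show ?thesis unfolding L_def by blast
qed simp

text \<open>The logarithms of the positive weights satisfy every affine relation among the
  functionals, hence are the values of an affine function at the functionals.\<close>

lemma toric_set_is_softmax:
  assumes w: "w \<in> toric_set \<xi> K"
  obtains L p where "L \<in> faces" "w = softmax \<xi> L p"
proof -
  define L where "L = {k\<in>K. 0 < w k}"
  have L: "L \<in> faces" unfolding L_def by (rule toric_set_support_face[OF w])
  note fL = faceD[OF L]
  have "w \<in> weight_simplex K" using w toric_set_subset_simplex by blast
  note wD = weight_simplexD[OF this]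
  have w0: "w k = 0" if "k \<notin> L" for k using that wD(1,2)[of k] unfolding L_def by force
  \<comment> \<open>The extra coordinate 1 turns affine relations into linear ones and will account
    for the normalising constant.\<close>
  define z where "z k = (riesz (\<xi> k), 1::real)" for k
  have injz: "inj_on z L"
    using inj_on_functionals fL by (auto simp: inj_on_def z_def riesz_eq_iff)
  \<comment> \<open>\<open>g\<close> is prescribed only on a basis \<open>Z\<close> chosen among the
    vectors \<open>z k\<close>; the relations then give the right values at the others.\<close>
  obtain Z where Z: "Z \<subseteq> z ` L" "independent Z" "z ` L \<subseteq> span Z"
    using real_vector.maximal_independent_subset[of "z ` L"] by metis
  define y where "y x = ln (w (inv_into L z x))" for x
  obtain g where g: "linear g" "\<And>x. x \<in> Z \<Longrightarrow> g x = y x"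
    using linear_independent_extend[OF Z(2), of y] by blast
  have yz: "y (z k) = ln (w k)" if "k \<in> L" for k
    using that injz by (simp add: y_def)
  have finZ: "finite Z" using Z(1) fL(3) finite_surj by blast
  have gz: "g (z k) = ln (w k)" if k: "k \<in> L" for k
  proof -
    obtain c where c: "z k = (\<Sum>x\<in>Z. c x *\<^sub>R x)"
      using Z(3) k unfolding span_finite[OF finZ] by auto
    define J where "J = {j\<in>L. z j \<in> Z}"
    have ZJ: "Z = z ` J" unfolding J_def using Z(1) by auto
    have J: "J \<subseteq> L" "inj_on z J" using injz unfolding J_def by (auto intro: inj_on_subset)
    define e where "e j = (if j \<in> J then c (z j) else 0)" for j
    \<comment> \<open>The affine relation expressing \<open>z k\<close> through the basis. It
      vanishes off \<open>L\<close>, where the weights are 0.\<close>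
    define d where "d j = (if j = k then 1 else 0) - e j" for j
    have JK: "J \<subseteq> K" using J fL by blast
    have kK: "k \<in> K" using k fL by blast
    have sume: "(\<Sum>j\<in>K. e j *\<^sub>R f j) = (\<Sum>j\<in>J. c (z j) *\<^sub>R f j)" for f :: "nat \<Rightarrow> 'c::real_vector"
      unfolding e_def using JK fin by (intro sum.mono_neutral_cong_right) auto
    have sumd: "(\<Sum>j\<in>K. d j *\<^sub>R f j) = f k - (\<Sum>j\<in>J. c (z j) *\<^sub>R f j)" for f :: "nat \<Rightarrow> 'c::real_vector"
      unfolding d_def sume[symmetric] using kK fin
      by (simp add: scaleR_left_diff_distrib sum_subtractf if_distrib[of "\<lambda>c. c *\<^sub>R _"] cong: if_cong)
    have cz: "z k = (\<Sum>j\<in>J. c (z j) *\<^sub>R z j)" using c unfolding ZJ using J by (simp add: sum.reindex)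
    have "(\<Sum>j\<in>K. d j *\<^sub>R z j) = 0" unfolding sumd cz[symmetric] by simp
    then have "(\<Sum>j\<in>K. d j *\<^sub>R riesz (\<xi> j)) = 0 \<and> sum d K = 0"
      by (simp add: z_def prod_eq_iff fst_sum snd_sum)
    then have "sum d K = 0" "riesz (moment \<xi> K d) = riesz 0"
      unfolding riesz_moment by (auto simp: moment_def riesz_def)
    moreover have "0 < w j" if "j \<in> K" "0 < d j" for j
      using that k J unfolding d_def e_def by (auto simp: L_def split: if_splits)
    ultimately have "(\<Sum>j\<in>K. d j * ln (w j)) = 0"
      by (intro toric_set_ln_relation_signed[OF fin w]) (auto simp: riesz_eq_iff)
    then have "ln (w k) = (\<Sum>j\<in>J. c (z j) * ln (w j))"
      using sumd[of "\<lambda>j. ln (w j)"] by simp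
    also have "\<dots> = (\<Sum>j\<in>J. c (z j) * g (z j))"
      using g(2) yz J ZJ by (intro sum.cong) auto
    also have "\<dots> = g (z k)"
      unfolding cz using g(1) by (simp add: linear_sum linear_cmul)
    finally show ?thesis by simp
  qed
  \<comment> \<open>The vector representing \<open>g\<close> splits into the point \<open>p\<close>
    and a constant \<open>c\<close> pairing with the extra coordinate.\<close>
  define p where "p = fst (adjoint g 1)"
  define c where "c = snd (adjoint g 1)"
  have "ln (w k) = blinfun_apply (\<xi> k) p + c" if "k \<in> L" for k
  proof -
    have "g (z k) = adjoint g 1 \<bullet> z k" using adjoint_works[OF g(1), of "z k" 1] by (simp add: inner_commute)
    then show ?thesis using gz[OF that] riesz_inner[of "\<xi> k" p]
      by (simp add: inner_prod_def z_def p_def c_def inner_commute)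
  qed
  then have wk: "w k = exp c * exp (blinfun_apply (\<xi> k) p)" if "k \<in> L" for k
    using that by (metis (no_types, lifting) L_def add.commute exp_add exp_ln mem_Collect_eq)
  have "1 = sum w L" using wD(3) w0 fL fin by (metis DiffD2 sum.mono_neutral_right)
  also have "\<dots> = exp c * b_val \<xi> L p" unfolding b_val_def sum_distrib_left by (intro sum.cong wk) auto
  finally have "exp c = 1 / b_val \<xi> L p" using b_val_pos[OF fL(3,2), of \<xi> p] by (simp add: field_simps)
  then have "w = softmax \<xi> L p" using wk w0 by (auto simp: softmax_def fun_eq_iff)
  then show thesis using L that by blast
qed

lemma toric_set_eq: "toric_set \<xi> K = (\<Union>L\<in>faces. range (softmax \<xi> L))"
proof (intro subset_antisym subsetI)
  fix w assume "w \<in> toric_set \<xi> K"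
  then obtain L p where "L \<in> faces" "w = softmax \<xi> L p" by (rule toric_set_is_softmax)
  then show "w \<in> (\<Union>L\<in>faces. range (softmax \<xi> L))" by blast
qed (use softmax_in_toric_set in blast)

text \<open>A point of the open face has positive coefficients \<open>\<gamma>\<close> on
  \<open>L\<close> and is also the moment of some toric weight \<open>w\<close>. Having equal
  moments, \<open>w\<close> and \<open>\<gamma>\<close> lie on the same faces, so the support of
  \<open>w\<close> is exactly \<open>L\<close>.\<close>

lemma range_c_vec:
  assumes L: "L \<in> faces"
  shows "range (c_vec \<xi> L) = open_face \<xi> L"
proof (intro subset_antisym image_subsetI subsetI)
  note fL = faceD[OF L]
  fix p
  show "c_vec \<xi> L p \<in> open_face \<xi> L"
    unfolding open_face_eq[OF fL(3)] using softmax_pos_iff[OF fL(3), of \<xi> p] sum_softmax[OF fL(3,2)]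
    by (auto simp: moment_softmax[symmetric])
next
  note fL = faceD[OF L]
  fix \<zeta> assume "\<zeta> \<in> open_face \<xi> L"
  then obtain c where c: "\<zeta> = moment \<xi> L c" "\<And>k. k \<in> L \<Longrightarrow> 0 < c k" "sum c L = 1"
    unfolding open_face_eq[OF fL(3)] by blast
  define \<gamma> where "\<gamma> k = (if k \<in> L then c k else 0)" for k
  have \<gamma>: "\<gamma> \<in> weight_simplex K" "moment \<xi> K \<gamma> = \<zeta>"
  proof -
    have "sum \<gamma> K = sum \<gamma> L" using fL fin by (intro sum.mono_neutral_right) (auto simp: \<gamma>_def)
    also have "\<dots> = 1" using c by (simp add: \<gamma>_def)
    finally show "\<gamma> \<in> weight_simplex K"
      unfolding weight_simplex_def using fL c(2) by (auto simp: \<gamma>_def intro: less_imp_le)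
    show "moment \<xi> K \<gamma> = \<zeta>"
      using moment_superset[of K L \<gamma> \<xi>] fL fin c(1) by (simp add: \<gamma>_def moment_def)
  qed
  note \<gamma>D = weight_simplexD[OF \<gamma>(1)]
  obtain w where w: "w \<in> toric_set \<xi> K" "moment \<xi> K w = \<zeta>"
    using moment_image_toric_set[OF fin, of \<xi>] \<gamma> by (metis (no_types, lifting) imageE imageI)
  then obtain M p where M: "M \<in> faces" "w = softmax \<xi> M p" using toric_set_is_softmax by metis
  have "w \<in> weight_simplex K" using w toric_set_subset_simplex by blast
  note wD = weight_simplexD[OF this]
  have supp: "0 < w k \<longleftrightarrow> k \<in> M" for k using M softmax_pos_iff faceD(3) by blast
  have eq: "sum w K = sum \<gamma> K" "moment \<xi> K w = moment \<xi> K \<gamma>" using wD(3) \<gamma>D(3) w(2) \<gamma>(2) by auto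
  have "k \<in> M" if "k \<in> L" for k
  proof (rule support_subset_face[OF M(1) wD(2) \<gamma>D(2) eq])
    show "0 < \<gamma> k" using c(2)[OF that] that by (simp add: \<gamma>_def)
    show "k \<in> K" using that fL(1) by blast
  qed (use supp in blast)
  moreover have "k \<in> L" if "k \<in> M" for k
  proof (rule support_subset_face[OF L \<gamma>D(2) wD(2) eq[symmetric]])
    show "0 < w k" "k \<in> K" using supp that faceD(1)[OF M(1)] by blast+
  qed (simp add: \<gamma>_def split: if_splits)
  ultimately have "M = L" by blast
  then have "\<zeta> = c_vec \<xi> L p" using w M moment_softmax_face[OF L] by simp
  then show "\<zeta> \<in> range (c_vec \<xi> L)" by blast
qed

text \<open>An instance of the bipolar theorem: a hyperplane separating \<open>\<zeta>\<close> from
  the hull has a normal which, suitably scaled, lies in the polyhedron and violates the bound for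
  \<open>\<zeta>\<close>.\<close>

lemma dual_polyhedron_eq:
  "dual_polyhedron {u. \<forall>k\<in>K. blinfun_apply (\<xi> k) u \<le> 1} = convex hull (\<xi> ` K)"
proof (intro subset_antisym subsetI)
  fix \<zeta> assume "\<zeta> \<in> convex hull (\<xi> ` K)"
  then obtain w where w: "w \<in> weight_simplex K" "\<zeta> = moment \<xi> K w"
    unfolding moment_image_weight_simplex[OF fin, symmetric] by blast
  note wD = weight_simplexD[OF w(1)]
  show "\<zeta> \<in> dual_polyhedron {u. \<forall>k\<in>K. blinfun_apply (\<xi> k) u \<le> 1}"
    unfolding dual_polyhedron_def
  proof clarify
    fix u assume u: "\<forall>k\<in>K. blinfun_apply (\<xi> k) u \<le> 1"
    have "blinfun_apply \<zeta> u \<le> (\<Sum>k\<in>K. w k * 1)"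
      unfolding w(2) moment_blinfun_apply using u wD(2) by (intro sum_mono mult_left_mono) auto
    then show "blinfun_apply \<zeta> u \<le> 1" using wD(3) by simp
  qed
next
  fix \<zeta> assume \<zeta>: "\<zeta> \<in> dual_polyhedron {u. \<forall>k\<in>K. blinfun_apply (\<xi> k) u \<le> 1}"
  let ?P = "convex hull (\<xi> ` K)"
  show "\<zeta> \<in> ?P"
  proof (rule ccontr)
    assume "\<zeta> \<notin> ?P"
    then have "riesz \<zeta> \<notin> riesz ` ?P" by (auto simp: riesz_eq_iff)
    moreover have "convex (riesz ` ?P)"
      by (intro convex_linear_image bounded_linear.linear[OF bounded_linear_riesz] convex_convex_hull)
    moreover have "compact (riesz ` ?P)"
      using fin by (intro compact_continuous_image linear_continuous_on bounded_linear_riesz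
          finite_imp_compact_convex_hull finite_imageI)
    ultimately obtain a b where ab: "a \<bullet> riesz \<zeta> < b" "\<And>x. x \<in> riesz ` ?P \<Longrightarrow> b < a \<bullet> x"
      using separating_hyperplane_closed_point compact_imp_closed by metis
    have z: "- b < blinfun_apply \<zeta> (- a)"
      using ab(1) by (simp add: riesz_inner[symmetric] inner_commute)
    have k: "blinfun_apply (\<xi> k) (- a) < - b" if "k \<in> K" for k
      using ab(2)[of "riesz (\<xi> k)"] that by (simp add: riesz_inner[symmetric] inner_commute hull_inc)
    \<comment> \<open>All functionals lie below \<open>- b\<close> at \<open>- a\<close>, and at
      least one of them is nonnegative there.\<close>
    have "0 < - b"
    proof (cases "a = 0")
      case True
      then show ?thesis using k K_nonempty by auto
    next
      case False
      then obtain j where "j \<in> K" "0 < blinfun_apply (\<xi> j) (- a)" using exists_pos[of "- a"] by auto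
      then show ?thesis using k[of j] by simp
    qed
    define u where "u = (- a) /\<^sub>R (- b)"
    have app: "blinfun_apply \<eta> u = blinfun_apply \<eta> (- a) / (- b)" for \<eta>
      by (simp only: u_def blinfun.scaleR_right divide_inverse real_scaleR_def mult.commute)
    have "blinfun_apply (\<xi> k) u \<le> 1" if "k \<in> K" for k
      unfolding app using k[OF that] \<open>0 < - b\<close> by (subst pos_divide_le_eq) auto
    then have "blinfun_apply \<zeta> u \<le> 1" using \<zeta> unfolding dual_polyhedron_def by auto
    moreover have "1 < blinfun_apply \<zeta> u"
      unfolding app using z \<open>0 < - b\<close> by (subst pos_less_divide_eq) auto
    ultimately show False by simp
  qed
qed

end

section \<open>Functionals of the facets\<close>

text \<open>A functional taking the value \<open>1\<close> on a facet is determined by the supporting hyperplane,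
  because the facet spans that hyperplane.\<close>

lemma facet_functional_le_1:
  fixes \<zeta> :: "'a::euclidean_space \<Rightarrow>\<^sub>L real"
  assumes poly: "polyhedron B" and int0: "0 \<in> interior B" and F: "F facet_of B"
    and one: "\<And>x. x \<in> F \<Longrightarrow> blinfun_apply \<zeta> x = 1" and u: "u \<in> B"
  shows "blinfun_apply \<zeta> u \<le> 1"
proof -
  obtain a b where ab: "a \<noteq> 0" "B \<subseteq> {x. a \<bullet> x \<le> b}" "F = B \<inter> {x. a \<bullet> x = b}"
    using facet_of_polyhedron[OF poly F] by metis
  have "interior B \<subseteq> interior {x. a \<bullet> x \<le> b}" using ab(2) by (rule interior_mono)
  then have b: "0 < b" using int0 ab(1) by (auto simp: interior_halfspace_le)
  have "aff_dim B = DIM('a)" using int0 by (intro aff_dim_nonempty_interior) auto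
  then have dim: "aff_dim F = DIM('a) - 1" and ne: "F \<noteq> {}" using F by (auto simp: facet_of_def)
  obtain f where f: "f \<in> F" using ne by blast
  \<comment> \<open>A hyperplane containing \<open>F\<close> has the dimension of \<open>F\<close>,
    hence is its affine hull; so the supporting hyperplane and the level set of
    \<open>\<zeta>\<close> coincide.\<close>
  have hull: "affine hull F = H" if "F \<subseteq> H" "affine H" "aff_dim H = DIM('a) - 1" for H
    by (rule affine_dim_equal) (use that dim ne in \<open>auto simp: hull_minimal\<close>)
  have h1: "affine hull F = {x. a \<bullet> x = b}"
    using ab by (intro hull) (auto simp: affine_hyperplane)
  have "riesz \<zeta> \<noteq> 0" using one[OF f] riesz_inner[of \<zeta> f] by auto
  then have "affine hull F = {x. riesz \<zeta> \<bullet> x = 1}"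
  proof (intro hull)
    show "F \<subseteq> {x. riesz \<zeta> \<bullet> x = 1}" using one by (auto simp: riesz_inner)
  qed (auto simp: affine_hyperplane)
  then have H: "a \<bullet> x = b \<longleftrightarrow> blinfun_apply \<zeta> x = 1" for x
    using h1 by (auto simp: riesz_inner set_eq_iff)
  have af: "a \<bullet> f = b" using f ab(3) by simp
  have "blinfun_apply \<zeta> u = (a \<bullet> u) / b"
  proof -
    \<comment> \<open>Chosen so that \<open>u + t *\<^sub>R f\<close> lies on the common
      hyperplane.\<close>
    define t where "t = 1 - (a \<bullet> u) / b"
    have "a \<bullet> (u + t *\<^sub>R f) = b" using b by (simp add: inner_add_right af t_def field_simps)
    then have "blinfun_apply \<zeta> (u + t *\<^sub>R f) = 1" using H by blast
    then show ?thesis using one[OF f] by (simp add: blinfun.add_right blinfun.scaleR_right t_def)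
  qed
  also have "\<dots> \<le> 1" using ab(2) u b by auto
  finally show ?thesis .
qed

text \<open>If \<open>u\<close> satisfies the inequalities but lies outside \<open>B\<close>, the
  segment from 0 to \<open>u\<close> meets the frontier at some \<open>t *\<^sub>R u\<close> on a
  facet \<open>A k\<close>. Then \<open>1 = t * \<xi> k u \<le> t\<close>, so \<open>t = 1\<close>
  and \<open>u\<close> lies in \<open>B\<close> after all.\<close>

lemma polyhedron_eq_facet_functionals:
  fixes \<xi> :: "nat \<Rightarrow> 'a::euclidean_space \<Rightarrow>\<^sub>L real"
  assumes poly: "polyhedron B" and int0: "0 \<in> interior B"
    and bij: "bij_betw A K {F. F facet_of B}"
    and A: "\<And>j. j \<in> K \<Longrightarrow> A j = {v \<in> B. blinfun_apply (\<xi> j) v = 1}"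
  shows "B = {u. \<forall>k\<in>K. blinfun_apply (\<xi> k) u \<le> 1}"
proof (intro subset_antisym subsetI CollectI ballI)
  fix u k assume "u \<in> B" and k: "k \<in> K"
  moreover have "A k facet_of B" using bij k by (auto simp: bij_betw_def)
  ultimately show "blinfun_apply (\<xi> k) u \<le> 1"
    by (rule_tac facet_functional_le_1[OF poly int0]) (auto simp: A)
next
  fix u assume u: "u \<in> {u. \<forall>k\<in>K. blinfun_apply (\<xi> k) u \<le> 1}"
  show "u \<in> B"
  proof (rule ccontr)
    assume "u \<notin> B"
    have "0 \<in> B" using int0 interior_subset by blast
    have "closed_segment 0 u \<inter> frontier B \<noteq> {}"
    proof (rule connected_Int_frontier)
      show "connected (closed_segment 0 u)" by simp
      show "closed_segment 0 u \<inter> B \<noteq> {}" using \<open>0 \<in> B\<close> by auto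
      show "closed_segment 0 u - B \<noteq> {}" using \<open>u \<notin> B\<close> by auto
    qed
    then obtain z where z: "z \<in> closed_segment 0 u" "z \<in> frontier B" by blast
    have "rel_interior B = interior B" using int0 by (intro rel_interior_nonempty_interior) auto
    then have "z \<in> rel_frontier B" using z(2) by (simp add: rel_frontier_def frontier_def)
    then obtain F where "F facet_of B" "z \<in> F" unfolding rel_frontier_of_polyhedron[OF poly] by blast
    then obtain k where k: "k \<in> K" "z \<in> A k" using bij unfolding bij_betw_def by blast
    then have z1: "blinfun_apply (\<xi> k) z = 1" "z \<in> B" using A by auto
    obtain t where t: "0 \<le> t" "t \<le> 1" "z = t *\<^sub>R u" using z(1) by (auto simp: in_segment)
    have "t * blinfun_apply (\<xi> k) u = 1" using z1 t by (simp add: blinfun.scaleR_right)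
    moreover have "t * blinfun_apply (\<xi> k) u \<le> t * 1" using u k t by (intro mult_left_mono) auto
    ultimately have "t = 1" using t by simp
    then show False using t z1 \<open>u \<notin> B\<close> by simp
  qed
qed

text \<open>A nonzero \<open>u\<close> violating \<open>definite\<close> would span a ray inside the
  bounded \<open>B\<close>. For \<open>vertex\<close>, a relative interior point of a facet lies on
  no other facet: otherwise the first facet would be a proper face of the second, of smaller
  dimension.\<close>

lemma polyhedral_norm_facets:
  fixes \<xi> :: "nat \<Rightarrow> 'a::euclidean_space \<Rightarrow>\<^sub>L real"
  assumes bnd: "bounded B" and poly: "polyhedron B" and int0: "0 \<in> interior B"
    and fin: "finite K" and bij: "bij_betw A K {F. F facet_of B}"
    and A: "\<And>j. j \<in> K \<Longrightarrow> A j = {v \<in> B. blinfun_apply (\<xi> j) v = 1}"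
  shows "polyhedral_norm K \<xi>"
proof
  have B: "B = {u. \<forall>k\<in>K. blinfun_apply (\<xi> k) u \<le> 1}"
    by (rule polyhedron_eq_facet_functionals[OF poly int0 bij A])
  show "finite K" by (rule fin)
  show "u = 0" if le: "\<And>k. k \<in> K \<Longrightarrow> blinfun_apply (\<xi> k) u \<le> 0" for u
  proof (rule ccontr)
    assume "u \<noteq> 0"
    obtain M where M: "0 < M" "\<And>x. x \<in> B \<Longrightarrow> norm x \<le> M" using bnd bounded_pos by metis
    define t where "t = (M + 1) / norm u"
    have t: "0 < t" using M(1) \<open>u \<noteq> 0\<close> by (simp add: t_def)
    have "blinfun_apply (\<xi> k) (t *\<^sub>R u) \<le> 1" if "k \<in> K" for k
      using mult_nonneg_nonpos[OF less_imp_le[OF t] le[OF that]] by (simp add: blinfun.scaleR_right)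
    then have "t *\<^sub>R u \<in> B" by (subst B) simp
    then have "norm (t *\<^sub>R u) \<le> M" by (rule M(2))
    moreover have "norm (t *\<^sub>R u) = M + 1" using M(1) \<open>u \<noteq> 0\<close> by (simp add: t_def)
    ultimately show False by simp
  qed
  fix k assume k: "k \<in> K"
  have facet: "A j facet_of B" if "j \<in> K" for j using bij that by (auto simp: bij_betw_def)
  have face: "A j face_of B" "A j \<noteq> {}" "aff_dim (A j) = aff_dim B - 1" if "j \<in> K" for j
    using facet[OF that] by (auto simp: facet_of_def)
  have "convex (A k)" using face(1)[OF k] face_of_imp_convex by blast
  then obtain v where v: "v \<in> rel_interior (A k)" using face(2)[OF k] rel_interior_eq_empty by blast
  then have vA: "v \<in> A k" using rel_interior_subset by blast
  then have vB: "v \<in> B" "blinfun_apply (\<xi> k) v = 1" using A[OF k] by auto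
  have "blinfun_apply (\<xi> j) v < 1" if j: "j \<in> K - {k}" for j
  proof (rule ccontr)
    assume "\<not> ?thesis"
    moreover have "blinfun_apply (\<xi> j) v \<le> 1" using vB(1) j by (subst (asm) B) auto
    ultimately have "v \<in> A j" using vB A[of j] j by auto
    then have "A k \<subseteq> A j"
      using face(1)[of j] j v A[OF k] by (intro subset_of_face_of[of "A j" B "A k"]) auto
    moreover have "A k \<noteq> A j" using bij j k by (auto simp: bij_betw_def inj_on_def)
    moreover have "A k face_of A j"
      using face(1)[OF k] face(1)[of j] j calculation(1) face_of_imp_subset face_of_subset by (metis DiffD1)
    ultimately have "aff_dim (A k) < aff_dim (A j)"
      using face_of_aff_dim_lt[of "A j" "A k"] face(1)[of j] j face_of_imp_convex by blast
    then show False using face(3)[OF k] face(3)[of j] j by simp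
  qed
  then show "\<exists>v. blinfun_apply (\<xi> k) v = 1 \<and> (\<forall>j\<in>K - {k}. blinfun_apply (\<xi> j) v < 1)"
    using vB(2) by blast
qed

section \<open>The bordification\<close>

lemma openin_pointwise_ball:
  assumes "0 < e"
  shows "openin bounded_uniform_topology
    {h \<in> pointed_continuous_functions. \<bar>h x - f x\<bar> < e}"
  unfolding openin_bounded_uniform_topology bounded_uniform_open_def
proof (intro conjI ballI)
  fix h assume h: "h \<in> {h \<in> pointed_continuous_functions. \<bar>h x - f x\<bar> < e}"
  show "\<exists>S d. bounded S \<and> 0 < d \<and> {g \<in> pointed_continuous_functions. \<forall>x\<in>S. \<bar>g x - h x\<bar> < d}
      \<subseteq> {h \<in> pointed_continuous_functions. \<bar>h x - f x\<bar> < e}"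
    using h by (intro exI[of _ "{x}"] exI[of _ "e - \<bar>h x - f x\<bar>"]) auto
qed auto

lemma Hausdorff_bounded_uniform_topology: "Hausdorff_space bounded_uniform_topology"
  unfolding Hausdorff_space_def topspace_bounded_uniform_topology
proof (intro allI impI)
  fix f g :: "'a \<Rightarrow> real"
  assume fg: "f \<in> pointed_continuous_functions \<and> g \<in> pointed_continuous_functions \<and> f \<noteq> g"
  then obtain x where x: "f x \<noteq> g x" by blast
  define e where "e = \<bar>f x - g x\<bar> / 2"
  have e: "0 < e" using x by (simp add: e_def)
  let ?U = "\<lambda>f. {h \<in> pointed_continuous_functions. \<bar>h x - f x\<bar> < e}"
  have "disjnt (?U f) (?U g)" unfolding disjnt_iff e_def by (auto simp: field_simps abs_if split: if_splits)
  then show "\<exists>U V. openin bounded_uniform_topology U \<and> openin bounded_uniform_topology V \<and>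
      f \<in> U \<and> g \<in> V \<and> disjnt U V"
    using fg e openin_pointwise_ball[OF e, of x f] openin_pointwise_ball[OF e, of x g]
    by (intro exI[of _ "?U f"] exI[of _ "?U g"]) auto
qed

text \<open>A bounded \<open>S\<close> has compact closure, and joint continuity on a product with a
  compact factor is uniform in that factor.\<close>

lemma continuous_map_bounded_uniformI:
  fixes h :: "'w::topological_space \<Rightarrow> 'a::euclidean_space \<Rightarrow> real"
  assumes cont: "continuous_on (W \<times> UNIV) (\<lambda>(w, x). h w x)"
    and zero: "\<And>w. w \<in> W \<Longrightarrow> h w 0 = 0"
  shows "continuous_map (top_of_set W) bounded_uniform_topology h"
  unfolding continuous_map_def topspace_bounded_uniform_topology topspace_euclidean_subtopology
proof (intro conjI allI impI)
  show "h \<in> W \<rightarrow> pointed_continuous_functions"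
  proof
    fix w assume w: "w \<in> W"
    have "continuous_on UNIV (\<lambda>x. (\<lambda>(w, x). h w x) (w, x))"
      by (rule continuous_on_compose2[OF cont]) (auto intro!: continuous_intros simp: w)
    then show "h w \<in> pointed_continuous_functions"
      using zero[OF w] by (simp add: pointed_continuous_functions_def)
  qed
  then have PC: "\<And>w. w \<in> W \<Longrightarrow> h w \<in> pointed_continuous_functions" by blast
  fix U :: "('a \<Rightarrow> real) set" assume "openin bounded_uniform_topology U"
  then have U: "bounded_uniform_open U" by (simp add: openin_bounded_uniform_topology)
  show "openin (top_of_set W) {w \<in> W. h w \<in> U}"
  proof (subst openin_subopen, intro ballI)
    fix w assume w: "w \<in> {w \<in> W. h w \<in> U}"
    obtain S e where S: "bounded S" "0 < e"
      "{g \<in> pointed_continuous_functions. \<forall>x\<in>S. \<bar>g x - h w x\<bar> < e} \<subseteq> U"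
      by (rule bounded_uniform_openE[OF U, of "h w"]) (use w in auto)
    have cont': "continuous_on (W \<times> closure S) (\<lambda>(w, x). h w x)"
      by (rule continuous_on_subset[OF cont]) auto
    \<comment> \<open>Compactness yields a non-strict bound, hence \<open>e / 2\<close>.\<close>
    obtain X where X: "w \<in> X" "open X"
      "\<forall>v\<in>X \<inter> W. \<forall>x\<in>closure S. dist (h v x) (h w x) \<le> e / 2"
      using continuous_on_prod_compactE[OF cont', of w "e / 2"] S(1,2) w
      by (auto simp: compact_closure)
    have "h v \<in> U" if v: "v \<in> X \<inter> W" for v
    proof -
      have "\<bar>h v x - h w x\<bar> < e" if "x \<in> S" for x
        using X(3) v that S(2) closure_subset[of S] by (force simp: dist_real_def)
      then show ?thesis using S(3) PC v by blast
    qed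
    then show "\<exists>T. openin (top_of_set W) T \<and> w \<in> T \<and> T \<subseteq> {w \<in> W. h w \<in> U}"
      using X w by (intro exI[of _ "W \<inter> X"]) (auto simp: openin_open)
  qed
qed

lemma tendsto_Max:
  fixes f :: "'i \<Rightarrow> 'b \<Rightarrow> 'c::linorder_topology"
  assumes "finite K" "K \<noteq> {}" "\<And>k. k \<in> K \<Longrightarrow> ((\<lambda>x. f k x) \<longlongrightarrow> l k) F"
  shows "((\<lambda>x. MAX k\<in>K. f k x) \<longlongrightarrow> (MAX k\<in>K. l k)) F"
  using assms
proof (induction rule: finite_ne_induct)
  case (insert k K)
  then show ?case by (auto intro!: tendsto_max)
qed auto

lemma continuous_on_Max:
  fixes f :: "'i \<Rightarrow> 'b::topological_space \<Rightarrow> 'c::linorder_topology"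
  assumes "finite K" "K \<noteq> {}" "\<And>k. k \<in> K \<Longrightarrow> continuous_on S (f k)"
  shows "continuous_on S (\<lambda>x. MAX k\<in>K. f k x)"
  using assms unfolding continuous_on_def by (blast intro: tendsto_Max)

lemma Max_image_mult_left:
  fixes f :: "'i \<Rightarrow> real"
  assumes "finite K" "K \<noteq> {}" "0 \<le> c"
  shows "c * (MAX k\<in>K. f k) = (MAX k\<in>K. c * f k)"
proof -
  have "mono ((*) c)" using assms(3) by (intro monoI mult_left_mono)
  then show ?thesis using mono_Max_commute[of "(*) c" "f ` K"] assms by (simp add: image_image)
qed

lemma homeomorphic_map_from_composition:
  assumes f: "homeomorphic_map X Y f" and gf: "homeomorphic_map X Z (g \<circ> f)"
  shows "homeomorphic_map Y Z g"
proof -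
  obtain f' where f': "homeomorphic_maps X Y f f'" using f homeomorphic_map_maps by blast
  then have "homeomorphic_map Y X f'" using homeomorphic_maps_map by blast
  then have "homeomorphic_map Y Z ((g \<circ> f) \<circ> f')" using gf by (rule homeomorphic_map_compose)
  then show ?thesis
    by (rule homeomorphic_map_eq) (use f' in \<open>auto simp: homeomorphic_maps_def\<close>)
qed

section \<open>Horofunctions as functions of the weights\<close>

context polyhedral_norm
begin

definition weight_fun :: "(nat \<Rightarrow> real) \<Rightarrow> 'a \<Rightarrow> real" where
  "weight_fun w v = ln (MAX k\<in>K. w k * exp (- blinfun_apply (\<xi> k) v)) - ln (MAX k\<in>K. w k)"

lemma weight_fun_0: "weight_fun w 0 = 0"
  by (simp add: weight_fun_def blinfun.zero_right)

lemma Max_weight_pos: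
  assumes "w \<in> weight_simplex K" "\<And>k. k \<in> K \<Longrightarrow> 0 < f k"
  shows "0 < (MAX k\<in>K. w k * f k)"
proof -
  have "\<exists>k\<in>K. 0 < w k"
  proof (rule ccontr)
    assume "\<not> ?thesis"
    then have "\<forall>k\<in>K. w k = 0" using weight_simplexD(2)[OF assms(1)] by (simp add: antisym not_less)
    then show False using weight_simplexD(3)[OF assms(1)] by simp
  qed
  then obtain k where k: "k \<in> K" "0 < w k" by blast
  then have "0 < w k * f k" using assms(2) by simp
  also have "\<dots> \<le> (MAX k\<in>K. w k * f k)" using fin k(1) by (intro Max_ge) auto
  finally show ?thesis .
qed

lemma continuous_on_weight_fun:
  "continuous_on (weight_simplex K \<times> UNIV) (\<lambda>(w, v). weight_fun w v)"
proof -
  have w: "continuous_on S (\<lambda>x. fst x k)" for S :: "((nat \<Rightarrow> real) \<times> 'a) set" and k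
    by (rule continuous_on_compose2[OF continuous_on_product_coordinates continuous_on_fst])
      (auto intro: continuous_on_id)
  have "continuous_on (weight_simplex K \<times> UNIV)
      (\<lambda>x. ln (MAX k\<in>K. fst x k * exp (- blinfun_apply (\<xi> k) (snd x))) - ln (MAX k\<in>K. fst x k))"
    using Max_weight_pos Max_weight_pos[of _ "\<lambda>_. 1"]
    by (intro continuous_on_diff continuous_on_ln continuous_on_Max fin K_nonempty
        continuous_on_mult continuous_on_exp continuous_on_minus w
        blinfun.continuous_on continuous_on_const continuous_on_snd continuous_on_id)
      (auto simp: less_imp_neq[symmetric] dest!: less_imp_neq)
  then show ?thesis by (simp add: weight_fun_def case_prod_unfold)
qed

text \<open>Weights off \<open>L\<close> vanish and \<open>exp\<close> is increasing, so the maximum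
  is \<open>exp\<close> of the partial norm divided by \<open>b_val \<xi> L p\<close>; this
  denominator cancels in the difference of logarithms.\<close>

lemma weight_fun_softmax:
  assumes L: "L \<in> faces"
  shows "weight_fun (softmax \<xi> L p) = horofunction \<xi> L p"
proof
  fix v
  note fL = faceD[OF L]
  have b: "0 < b_val \<xi> L p" using fL by (intro b_val_pos)
  have M: "(MAX k\<in>K. softmax \<xi> L p k * exp (- blinfun_apply (\<xi> k) v)) =
      exp (partial_norm \<xi> L (p - v)) / b_val \<xi> L p" for v
  proof (rule Max_eqI)
    have val: "softmax \<xi> L p k * exp (- blinfun_apply (\<xi> k) v) =
        exp (blinfun_apply (\<xi> k) (p - v)) / b_val \<xi> L p" if "k \<in> L" for k
      using that by (simp add: softmax_def exp_diff exp_minus blinfun.diff_right field_simps)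
    show "y \<le> exp (partial_norm \<xi> L (p - v)) / b_val \<xi> L p"
      if y: "y \<in> (\<lambda>k. softmax \<xi> L p k * exp (- blinfun_apply (\<xi> k) v)) ` K" for y
    proof -
      obtain k where k: "k \<in> K" "y = softmax \<xi> L p k * exp (- blinfun_apply (\<xi> k) v)" using y by blast
      show ?thesis
      proof (cases "k \<in> L")
        case True
        then have "blinfun_apply (\<xi> k) (p - v) \<le> partial_norm \<xi> L (p - v)"
          unfolding partial_norm_def using fL by (intro Max_ge) auto
        then show ?thesis using b unfolding k(2) val[OF True] by (intro divide_right_mono) auto
      next
        case False
        then show ?thesis using b k by (simp add: softmax_def)
      qed
    qed
    have "partial_norm \<xi> L (p - v) \<in> (\<lambda>l. blinfun_apply (\<xi> l) (p - v)) ` L"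
      unfolding partial_norm_def using fL by (intro Max_in) auto
    then obtain l where l: "l \<in> L" "partial_norm \<xi> L (p - v) = blinfun_apply (\<xi> l) (p - v)" by blast
    then show "exp (partial_norm \<xi> L (p - v)) / b_val \<xi> L p
        \<in> (\<lambda>k. softmax \<xi> L p k * exp (- blinfun_apply (\<xi> k) v)) ` K"
      using val[OF l(1)] fL by (intro image_eqI[of _ _ l]) auto
  qed (use fin in simp)
  have "(MAX k\<in>K. softmax \<xi> L p k) = exp (partial_norm \<xi> L p) / b_val \<xi> L p"
    using M[of 0] by (simp add: blinfun.zero_right)
  then show "weight_fun (softmax \<xi> L p) v = horofunction \<xi> L p v"
    unfolding weight_fun_def horofunction_def M using b by (simp add: ln_div)
qed

text \<open>The weight of a vertex is read off along the ray through a point at which only that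
  vertex attains the norm.\<close>

lemma weight_fun_limit:
  assumes w: "w \<in> weight_simplex K" and k: "k \<in> K"
    and v: "blinfun_apply (\<xi> k) v = 1" "\<And>j. j \<in> K - {k} \<Longrightarrow> blinfun_apply (\<xi> j) v < 1"
  shows "((\<lambda>s. exp (weight_fun w (- s *\<^sub>R v) - s)) \<longlongrightarrow> w k / (MAX j\<in>K. w j)) at_top"
proof -
  let ?M = "MAX j\<in>K. w j"
  have M: "0 < ?M" using Max_weight_pos[OF w, of "\<lambda>_. 1"] by simp
  have exp_ln_diff: "exp (ln x - ln y - s) = exp (- s) * x / y" if "0 < x" "0 < y" for x y s :: real
    using that by (simp add: exp_diff exp_add exp_minus field_simps)
  \<comment> \<open>With the factor \<open>exp (- s)\<close> moved into the maximum, the term of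
    \<open>k\<close> is constant and all others decay.\<close>
  have eq: "exp (weight_fun w (- s *\<^sub>R v) - s) =
      (MAX j\<in>K. w j * exp ((blinfun_apply (\<xi> j) v - 1) * s)) / ?M" for s
  proof -
    let ?N = "MAX j\<in>K. w j * exp (- blinfun_apply (\<xi> j) (- s *\<^sub>R v))"
    have N: "0 < ?N" by (rule Max_weight_pos[OF w]) simp
    have "exp (weight_fun w (- s *\<^sub>R v) - s) = (exp (- s) * ?N) / ?M"
      unfolding weight_fun_def by (rule exp_ln_diff[OF N M])
    also have "exp (- s) * ?N = (MAX j\<in>K. exp (- s) * (w j * exp (- blinfun_apply (\<xi> j) (- s *\<^sub>R v))))"
      using fin K_nonempty by (intro Max_image_mult_left) auto
    also have "(\<lambda>j. exp (- s) * (w j * exp (- blinfun_apply (\<xi> j) (- s *\<^sub>R v)))) =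
        (\<lambda>j. w j * exp ((blinfun_apply (\<xi> j) v - 1) * s))"
      by (simp add: fun_eq_iff blinfun.scaleR_right blinfun.minus_right exp_minus exp_diff divide_inverse algebra_simps)
    finally show ?thesis .
  qed
  have "((\<lambda>s. MAX j\<in>K. w j * exp ((blinfun_apply (\<xi> j) v - 1) * s)) \<longlongrightarrow>
      (MAX j\<in>K. if j = k then w k else 0)) at_top"
  proof (rule tendsto_Max[OF fin K_nonempty])
    fix j assume j: "j \<in> K"
    show "((\<lambda>s. w j * exp ((blinfun_apply (\<xi> j) v - 1) * s)) \<longlongrightarrow> (if j = k then w k else 0)) at_top"
    proof (cases "j = k")
      case False
      then have "blinfun_apply (\<xi> j) v - 1 < 0" using v(2)[of j] j by simp
      then have "((\<lambda>s. w j * exp ((blinfun_apply (\<xi> j) v - 1) * s)) \<longlongrightarrow> w j * 0) at_top"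
        by (intro tendsto_mult tendsto_const) real_asymp
      then show ?thesis using False by simp
    qed (simp add: v)
  qed
  moreover have "(MAX j\<in>K. if j = k then w k else 0) = w k"
    using fin k weight_simplexD(2)[OF w, of k] by (intro Max_eqI) auto
  ultimately show ?thesis unfolding eq using M by (intro tendsto_divide tendsto_const) auto
qed

text \<open>The limits at the vertices recover the ratios of the weights to their maximum; as both
  weights have total mass 1, the maxima agree.\<close>

lemma inj_on_weight_fun: "inj_on weight_fun (weight_simplex K)"
proof (rule inj_onI)
  fix w u assume w: "w \<in> weight_simplex K" and u: "u \<in> weight_simplex K"
    and eq: "weight_fun w = weight_fun u"
  let ?M = "\<lambda>w. MAX j\<in>K. w j :: real"
  have M: "0 < ?M w" "0 < ?M u"
    using Max_weight_pos[OF w, of "\<lambda>_. 1"] Max_weight_pos[OF u, of "\<lambda>_. 1"] by auto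
  have q: "w k / ?M w = u k / ?M u" if k: "k \<in> K" for k
  proof -
    obtain v where v: "blinfun_apply (\<xi> k) v = 1" "\<And>j. j \<in> K - {k} \<Longrightarrow> blinfun_apply (\<xi> j) v < 1"
      using vertex[OF k] by blast
    show ?thesis
      using weight_fun_limit[OF w k v] weight_fun_limit[OF u k v] unfolding eq
      by (rule tendsto_unique[OF trivial_limit_at_top_linorder])
  qed
  have "1 / ?M w = (\<Sum>k\<in>K. w k / ?M w)"
    using weight_simplexD(3)[OF w] by (simp add: sum_divide_distrib[symmetric])
  also have "\<dots> = (\<Sum>k\<in>K. u k / ?M u)" by (intro sum.cong q) auto
  also have "\<dots> = 1 / ?M u"
    using weight_simplexD(3)[OF u] by (simp add: sum_divide_distrib[symmetric])
  finally have "?M w = ?M u" using M by simp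
  then have "w k = u k" if "k \<in> K" for k using q[OF that] M by simp
  then show "w = u" using weight_simplexD(1)[OF w] weight_simplexD(1)[OF u] by (metis ext)
qed

section \<open>Homeomorphisms from the compact space of weights\<close>

lemma homeomorphic_map_moment:
  "homeomorphic_map (top_of_set (toric_set \<xi> K)) (top_of_set (convex hull (\<xi> ` K))) (moment \<xi> K)"
proof (rule continuous_imp_homeomorphic_map)
  have im: "moment \<xi> K ` toric_set \<xi> K = convex hull (\<xi> ` K)"
    using moment_image_toric_set[OF fin] moment_image_weight_simplex[OF fin] by metis
  then show "moment \<xi> K ` topspace (top_of_set (toric_set \<xi> K)) =
      topspace (top_of_set (convex hull (\<xi> ` K)))" by simp
  show "continuous_map (top_of_set (toric_set \<xi> K)) (top_of_set (convex hull (\<xi> ` K))) (moment \<xi> K)"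
    using im by (simp add: continuous_on_moment image_subset_iff_funcset[symmetric])
  show "compact_space (top_of_set (toric_set \<xi> K))"
    using compact_toric_set[OF fin, of \<xi>] by (simp add: compact_space_subtopology)
  show "Hausdorff_space (top_of_set (convex hull (\<xi> ` K)))"
    by (intro Hausdorff_space_subtopology Hausdorff_space_euclidean)
  show "inj_on (moment \<xi> K) (topspace (top_of_set (toric_set \<xi> K)))"
    using inj_on_moment_toric_set[OF fin] by simp
qed

lemma K_face: "K \<in> faces" by simp

lemma open_face_subset: "open_face \<xi> L \<subseteq> convex hull (\<xi> ` K)" if "L \<in> faces"
proof -
  have "open_face \<xi> L \<subseteq> convex hull (\<xi> ` L)"
    unfolding open_face_def closed_face_def by (rule rel_interior_subset)
  also have "\<dots> \<subseteq> convex hull (\<xi> ` K)" using faceD(1)[OF that] by (intro hull_mono image_mono)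
  finally show ?thesis .
qed

text \<open>Mixing the coefficients with uniform ones makes them all positive, and the mixtures tend
  to the given point.\<close>

lemma convex_hull_subset_closure_open_face: "convex hull (\<xi> ` K) \<subseteq> closure (open_face \<xi> K)"
proof
  fix \<zeta> assume "\<zeta> \<in> convex hull (\<xi> ` K)"
  then obtain w where w: "w \<in> weight_simplex K" "\<zeta> = moment \<xi> K w"
    unfolding moment_image_weight_simplex[OF fin, symmetric] by blast
  note wD = weight_simplexD[OF w(1)]
  define c where "c k = 1 / real (card K)" for k :: nat
  have cK: "0 < card K" using fin K_nonempty by (simp add: card_gt_0_iff)
  define f where "f t = moment \<xi> K (\<lambda>k. (1 - t) * w k + t * c k)" for t :: real
  have "f ` {0<..<1} \<subseteq> open_face \<xi> K"
  proof (rule image_subsetI)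
    fix t :: real assume t: "t \<in> {0<..<1}"
    have "0 < (1 - t) * w k + t * c k" for k
      using t wD(2)[of k] cK by (intro add_nonneg_pos) (auto simp: c_def)
    moreover have "(\<Sum>k\<in>K. (1 - t) * w k + t * c k) = 1"
      using wD(3) cK by (simp add: sum.distrib sum_distrib_left[symmetric] c_def)
    ultimately show "f t \<in> open_face \<xi> K"
      unfolding open_face_eq[OF fin] f_def by blast
  qed
  moreover have "continuous_on (closure {0<..<1}) f"
    unfolding f_def moment_def by (intro continuous_intros)
  ultimately have "f ` closure {0<..<1} \<subseteq> closure (open_face \<xi> K)"
    using image_closure_subset[of "{0<..<1}" f "closure (open_face \<xi> K)"] closure_subset by auto
  then have "f 0 \<in> closure (open_face \<xi> K)" by auto
  then show "\<zeta> \<in> closure (open_face \<xi> K)" by (simp add: f_def w(2))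
qed

text \<open>The open face is dense in the dual polyhedron, and this density is pulled back along the
  moment homeomorphism.\<close>

lemma closure_of_softmax:
  "top_of_set (toric_set \<xi> K) closure_of range (softmax \<xi> K) = toric_set \<xi> K"
proof -
  let ?T = "toric_set \<xi> K" and ?P = "convex hull (\<xi> ` K)"
  have sub: "range (softmax \<xi> K) \<subseteq> ?T" using softmax_in_toric_set[OF K_face] by blast
  have "moment \<xi> K ` range (softmax \<xi> K) = open_face \<xi> K"
    unfolding range_c_vec[OF K_face, symmetric] image_image moment_softmax_face[OF K_face] ..
  moreover have "top_of_set ?P closure_of open_face \<xi> K = ?P"
    using convex_hull_subset_closure_open_face open_face_subset[OF K_face]
    by (auto simp: closure_of_subtopology inf.absorb2)
  ultimately have "moment \<xi> K ` (top_of_set ?T closure_of range (softmax \<xi> K)) = ?P"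
    using homeomorphic_map_closure_of[OF homeomorphic_map_moment, of "range (softmax \<xi> K)"] sub by simp
  also have "\<dots> = moment \<xi> K ` ?T"
    using homeomorphic_imp_surjective_map[OF homeomorphic_map_moment] by simp
  finally show ?thesis
    using inj_on_image_eq_iff[OF inj_on_moment_toric_set[OF fin, of \<xi>]]
      closure_of_subset_topspace[of "top_of_set ?T" "range (softmax \<xi> K)"] by simp
qed

text \<open>The generating functions are the images of the weights of full support. The image of the
  compact toric set is closed in a Hausdorff space, and continuity carries over the density of those
  weights.\<close>

lemma bordification_eq:
  "bordification \<xi> K = subtopology bounded_uniform_topology (weight_fun ` toric_set \<xi> K)"
  and weight_fun_subset: "weight_fun ` toric_set \<xi> K \<subseteq> pointed_continuous_functions"
  and continuous_map_weight_fun: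
    "continuous_map (top_of_set (toric_set \<xi> K)) bounded_uniform_topology weight_fun"
proof -
  let ?T = "toric_set \<xi> K"
  have "continuous_on (?T \<times> UNIV) (\<lambda>(w, v). weight_fun w v)"
    by (rule continuous_on_subset[OF continuous_on_weight_fun]) (use toric_set_subset_simplex in blast)
  then show cm: "continuous_map (top_of_set ?T) bounded_uniform_topology weight_fun"
    by (rule continuous_map_bounded_uniformI) (rule weight_fun_0)
  then show "weight_fun ` ?T \<subseteq> pointed_continuous_functions"
    using continuous_map_image_subset_topspace topspace_bounded_uniform_topology by fastforce
  have "range (\<lambda>p u. asym_dist \<xi> K p u - asym_dist \<xi> K p 0) = weight_fun ` range (softmax \<xi> K)"
    unfolding image_image weight_fun_softmax[OF K_face] by (simp add: asym_dist_def horofunction_def)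
  moreover have "bounded_uniform_topology closure_of (weight_fun ` range (softmax \<xi> K)) = weight_fun ` ?T"
  proof
    have "compactin bounded_uniform_topology (weight_fun ` ?T)"
      by (rule image_compactin[OF _ cm]) (simp add: compactin_subtopology compact_toric_set[OF fin])
    then have "closedin bounded_uniform_topology (weight_fun ` ?T)"
      by (rule compactin_imp_closedin[OF Hausdorff_bounded_uniform_topology])
    then show "bounded_uniform_topology closure_of (weight_fun ` range (softmax \<xi> K)) \<subseteq> weight_fun ` ?T"
      using softmax_in_toric_set[OF K_face] by (intro closure_of_minimal) auto
    show "weight_fun ` ?T \<subseteq> bounded_uniform_topology closure_of (weight_fun ` range (softmax \<xi> K))"
      using continuous_map_image_closure_subset[OF cm, of "range (softmax \<xi> K)"]
      unfolding closure_of_softmax .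
  qed
  ultimately show "bordification \<xi> K = subtopology bounded_uniform_topology (weight_fun ` ?T)"
    unfolding bordification_def by simp
qed

lemma topspace_bordification: "topspace (bordification \<xi> K) = weight_fun ` toric_set \<xi> K"
  using weight_fun_subset by (auto simp: bordification_eq topspace_bounded_uniform_topology)

lemma homeomorphic_map_weight_fun:
  "homeomorphic_map (top_of_set (toric_set \<xi> K)) (bordification \<xi> K) weight_fun"
proof (rule continuous_imp_homeomorphic_map)
  show "continuous_map (top_of_set (toric_set \<xi> K)) (bordification \<xi> K) weight_fun"
    using continuous_map_weight_fun by (simp add: bordification_eq continuous_map_in_subtopology)
  show "compact_space (top_of_set (toric_set \<xi> K))"
    using compact_toric_set[OF fin, of \<xi>] by (simp add: compact_space_subtopology)
  show "Hausdorff_space (bordification \<xi> K)"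
    unfolding bordification_eq by (intro Hausdorff_space_subtopology Hausdorff_bounded_uniform_topology)
  show "weight_fun ` topspace (top_of_set (toric_set \<xi> K)) = topspace (bordification \<xi> K)"
    by (simp add: topspace_bordification)
  show "inj_on weight_fun (topspace (top_of_set (toric_set \<xi> K)))"
    using inj_on_subset[OF inj_on_weight_fun toric_set_subset_simplex] by simp
qed

text \<open>The definite description in \<open>Phi\<close> is legitimate: a horofunction determines
  its weights by injectivity, and the weights determine the stratum and the point in it.\<close>

lemma Phi_horofunction:
  assumes L: "L \<in> faces"
  shows "Phi \<xi> K (horofunction \<xi> L p) = stratum_proj \<xi> K L p"
  unfolding Phi_def
proof (rule the_equality)
  show "\<exists>M\<in>faces. \<exists>q. horofunction \<xi> L p = horofunction \<xi> M q \<and>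
      stratum_proj \<xi> K L p = stratum_proj \<xi> K M q"
    using L by blast
  fix x assume "\<exists>M\<in>faces. \<exists>q. horofunction \<xi> L p = horofunction \<xi> M q \<and> x = stratum_proj \<xi> K M q"
  then obtain M q where M: "M \<in> faces" "horofunction \<xi> L p = horofunction \<xi> M q"
    "x = stratum_proj \<xi> K M q" by blast
  have "softmax \<xi> L p = softmax \<xi> M q"
    using inj_on_weight_fun M(2) softmax_in_simplex[OF L] softmax_in_simplex[OF M(1)]
    unfolding weight_fun_softmax[OF L, symmetric] weight_fun_softmax[OF M(1), symmetric]
    by (rule inj_onD)
  then show "x = stratum_proj \<xi> K L p" unfolding M(3) by (rule softmax_eqD(2)[OF L M(1), symmetric])
qed

text \<open>On the toric weights,
  \<open>c_map \<xi> K \<circ> Phi \<xi> K \<circ> weight_fun\<close> is the moment map, and the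
  homeomorphism \<open>weight_fun\<close> can be cancelled.\<close>

lemma homeomorphic_map_c_map_Phi:
  "homeomorphic_map (bordification \<xi> K) (top_of_set (convex hull (\<xi> ` K))) (c_map \<xi> K \<circ> Phi \<xi> K)"
proof (rule homeomorphic_map_from_composition[OF homeomorphic_map_weight_fun])
  show "homeomorphic_map (top_of_set (toric_set \<xi> K)) (top_of_set (convex hull (\<xi> ` K)))
      (c_map \<xi> K \<circ> Phi \<xi> K \<circ> weight_fun)"
  proof (rule homeomorphic_map_eq[OF homeomorphic_map_moment])
    fix w assume "w \<in> topspace (top_of_set (toric_set \<xi> K))"
    then obtain L p where Lp: "L \<in> faces" "w = softmax \<xi> L p" using toric_set_is_softmax by auto
    then show "moment \<xi> K w = (c_map \<xi> K \<circ> Phi \<xi> K \<circ> weight_fun) w"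
      by (simp add: moment_softmax_face[OF Lp(1)] weight_fun_softmax[OF Lp(1)] Phi_horofunction[OF Lp(1)] c_map_proj)
  qed
qed

lemma bij_betw_Phi: "bij_betw (Phi \<xi> K) (topspace (bordification \<xi> K)) (strata \<xi> K)"
proof -
  have "inj_on (Phi \<xi> K) (topspace (bordification \<xi> K))"
    using homeomorphic_imp_injective_map[OF homeomorphic_map_c_map_Phi] by (rule inj_on_imageI2)
  moreover have "Phi \<xi> K ` topspace (bordification \<xi> K) = strata \<xi> K"
  proof -
    have "Phi \<xi> K ` weight_fun ` range (softmax \<xi> L) = stratum \<xi> K L" if L: "L \<in> faces" for L
      unfolding image_image weight_fun_softmax[OF L] Phi_horofunction[OF L] stratum_def ..
    then show ?thesis
      unfolding topspace_bordification toric_set_eq strata_def image_UN by (intro SUP_cong) auto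
  qed
  ultimately show ?thesis by (simp add: bij_betw_def)
qed

lemma homeomorphic_map_Phi: "homeomorphic_map (bordification \<xi> K) (strata_topology \<xi> K) (Phi \<xi> K)"
  unfolding strata_topology_def by (rule homeomorphic_map_coinduced_topology[OF bij_betw_Phi])

lemma topspace_strata_topology: "topspace (strata_topology \<xi> K) = strata \<xi> K"
  using homeomorphic_imp_surjective_map[OF homeomorphic_map_Phi] bij_betw_Phi by (simp add: bij_betw_def)

lemma homeomorphic_map_c_map:
  "homeomorphic_map (strata_topology \<xi> K) (top_of_set (convex hull (\<xi> ` K))) (c_map \<xi> K)"
  by (rule homeomorphic_map_from_composition[OF homeomorphic_map_Phi homeomorphic_map_c_map_Phi])

lemma c_map_image_stratum: "L \<in> faces \<Longrightarrow> c_map \<xi> K ` stratum \<xi> K L = open_face \<xi> L"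
  by (simp only: stratum_def image_image c_map_proj range_c_vec)

lemma homeomorphic_map_c_map_subtopology:
  assumes L: "L \<in> faces"
  shows "homeomorphic_map (subtopology (strata_topology \<xi> K) (stratum \<xi> K L))
    (top_of_set (open_face \<xi> L)) (c_map \<xi> K)"
proof -
  have "stratum \<xi> K L \<subseteq> strata \<xi> K" using L unfolding strata_def by blast
  then have "c_map \<xi> K ` (topspace (strata_topology \<xi> K) \<inter> stratum \<xi> K L) =
      topspace (top_of_set (convex hull (\<xi> ` K))) \<inter> open_face \<xi> L"
    using c_map_image_stratum[OF L] open_face_subset[OF L]
    by (simp add: topspace_strata_topology inf.absorb2)
  from homeomorphic_map_subtopologies[OF homeomorphic_map_c_map this] show ?thesis
    using open_face_subset[OF L] by (simp add: subtopology_subtopology inf.absorb2)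
qed

section \<open>The quotient topology on each stratum\<close>

lemma c_vec_eqD:
  assumes "L \<in> faces" "M \<in> faces" "c_vec \<xi> L p = c_vec \<xi> M q"
  shows "softmax \<xi> L p = softmax \<xi> M q"
  using inj_onD[OF inj_on_moment_toric_set[OF fin]] assms
  by (metis moment_softmax_face softmax_in_toric_set)

text \<open>A continuous choice of representatives: inverting the moment map gives the weights,
  differences of their logarithms are the values \<open>\<xi> k p - \<xi> l p\<close>, and linear
  algebra reconstructs \<open>p\<close> from these modulo
  \<open>eq_subspace \<xi> L\<close>.\<close>

lemma c_vec_section:
  assumes L: "L \<in> faces"
  obtains s where "continuous_on (open_face \<xi> L) s" "\<And>\<zeta>. \<zeta> \<in> open_face \<xi> L \<Longrightarrow> c_vec \<xi> L (s \<zeta>) = \<zeta>"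
proof -
  note fL = faceD[OF L]
  obtain l where l: "l \<in> L" using fL by blast
  obtain \<psi> where \<psi>: "homeomorphic_maps (top_of_set (toric_set \<xi> K)) (top_of_set (convex hull (\<xi> ` K)))
      (moment \<xi> K) \<psi>"
    using homeomorphic_map_moment homeomorphic_map_maps by blast
  define r where "r k = riesz (\<xi> k)" for k
  \<comment> \<open>\<open>G p\<close> involves \<open>p\<close> only through the known differences,
    and \<open>G u \<bullet> u\<close> is a sum of squares, so the kernel of \<open>G\<close> lies
    in \<open>eq_subspace \<xi> L\<close>.\<close>
  define G where "G p = (\<Sum>k\<in>L. (blinfun_apply (\<xi> k) p - blinfun_apply (\<xi> l) p) *\<^sub>R (r k - r l))" for p
  have "linear G"
    unfolding G_def by (intro linear_compose_sum ballI linear_compose_scale_right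
      linearI) (auto simp: blinfun.add_right blinfun.scaleR_right algebra_simps)
  then obtain g where g: "linear g" "\<And>p. G (g (G p)) = G p"
    using linear_exists_right_inverse_on[of G UNIV] by auto
  have ker: "u \<in> eq_subspace \<xi> L" if "G u = 0" for u
  proof -
    have "0 = G u \<bullet> u" using that by simp
    also have "\<dots> = (\<Sum>k\<in>L. (blinfun_apply (\<xi> k) u - blinfun_apply (\<xi> l) u)\<^sup>2)"
      by (simp add: G_def inner_sum_left inner_diff_left r_def riesz_inner power2_eq_square)
    finally have "\<forall>k\<in>L. blinfun_apply (\<xi> k) u = blinfun_apply (\<xi> l) u"
      using fL(3) by (simp add: sum_nonneg_eq_0_iff)
    then show ?thesis unfolding eq_subspace_def by simp
  qed
  define s where "s \<zeta> = g (\<Sum>k\<in>L. (ln (\<psi> \<zeta> k) - ln (\<psi> \<zeta> l)) *\<^sub>R (r k - r l))" for \<zeta>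
  have \<psi>_c: "\<psi> (c_vec \<xi> L p) = softmax \<xi> L p" for p
    using \<psi> softmax_in_toric_set[OF L, of p]
    by (auto simp: homeomorphic_maps_def moment_softmax_face[OF L, symmetric])
  have pos: "0 < \<psi> \<zeta> k" if "\<zeta> \<in> open_face \<xi> L" "k \<in> L" for \<zeta> k
    using that \<psi>_c softmax_pos_iff[OF fL(3), of \<xi>] unfolding range_c_vec[OF L, symmetric] by auto
  have "continuous_on (convex hull (\<xi> ` K)) \<psi>"
    using \<psi> by (auto simp: homeomorphic_maps_def continuous_map_in_subtopology)
  then have cont\<psi>: "continuous_on (open_face \<xi> L) (\<lambda>\<zeta>. \<psi> \<zeta> k)" for k
    using open_face_subset[OF L]
    by (auto intro: continuous_on_compose2[OF continuous_on_product_coordinates] continuous_on_subset)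
  have "continuous_on UNIV g" using g(1) by (simp add: linear_continuous_on linear_conv_bounded_linear)
  moreover have "continuous_on (open_face \<xi> L)
      (\<lambda>\<zeta>. \<Sum>k\<in>L. (ln (\<psi> \<zeta> k) - ln (\<psi> \<zeta> l)) *\<^sub>R (r k - r l))"
  proof -
    have "continuous_on (open_face \<xi> L) (\<lambda>\<zeta>. ln (\<psi> \<zeta> k))" if "k \<in> L" for k
      by (rule continuous_on_ln[OF cont\<psi>]) (use pos[OF _ that] in force)
    then show ?thesis using l
      by (intro continuous_on_sum continuous_on_scaleR continuous_on_diff continuous_on_const)
  qed
  ultimately have "continuous_on (open_face \<xi> L) s"
    unfolding s_def by (rule continuous_on_compose2) simp
  moreover have "c_vec \<xi> L (s \<zeta>) = \<zeta>" if "\<zeta> \<in> open_face \<xi> L" for \<zeta>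
  proof -
    obtain p where p: "\<zeta> = c_vec \<xi> L p" using \<open>\<zeta> \<in> open_face \<xi> L\<close> unfolding range_c_vec[OF L, symmetric] by blast
    have b: "0 < b_val \<xi> L p" using fL by (intro b_val_pos)
    have "s \<zeta> = g (G p)"
      unfolding s_def G_def p \<psi>_c using b l
      by (intro arg_cong[of _ _ g] sum.cong) (auto simp: softmax_def ln_div)
    then have "G (s \<zeta> - p) = 0" using g(2) \<open>linear G\<close> by (simp add: linear_diff)
    then have "s \<zeta> - p \<in> eq_subspace \<xi> L" by (rule ker)
    then have "s \<zeta> \<in> eq_coset \<xi> L p" unfolding eq_coset_def by (intro image_eqI[of _ _ "s \<zeta> - p"]) auto
    then show ?thesis unfolding p by (rule c_vec_eq_coset)
  qed
  ultimately show thesis by (rule that)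
qed

lemma continuous_on_c_vec:
  assumes L: "L \<in> faces"
  shows "continuous_on S (c_vec \<xi> L)"
proof -
  have "(\<Sum>k\<in>L. exp (blinfun_apply (\<xi> k) p)) \<noteq> 0" for p
    using b_val_pos[OF faceD(3,2)[OF L], of \<xi> p] unfolding b_val_def by simp
  then show ?thesis
    unfolding c_vec_def a_vec_def b_val_def by (intro continuous_intros) auto
qed

text \<open>A continuous surjection with a continuous section is a quotient map.\<close>

lemma quotient_map_c_vec:
  assumes L: "L \<in> faces"
  shows "quotient_map euclidean (top_of_set (open_face \<xi> L)) (c_vec \<xi> L)"
proof -
  obtain s where s: "continuous_on (open_face \<xi> L) s" "\<And>\<zeta>. \<zeta> \<in> open_face \<xi> L \<Longrightarrow> c_vec \<xi> L (s \<zeta>) = \<zeta>"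
    using c_vec_section[OF L] by blast
  have "open {x. c_vec \<xi> L x \<in> U} \<longleftrightarrow> openin (top_of_set (open_face \<xi> L)) U"
    if "U \<subseteq> open_face \<xi> L" for U
    using continuous_right_inverse_imp_quotient_map[OF continuous_on_c_vec[OF L, of UNIV] _ s(1) _ s(2) that]
    by (auto simp: range_c_vec[OF L, symmetric] vimage_def)
  then show ?thesis
    unfolding quotient_map_def by (simp add: range_c_vec[OF L])
qed

lemma quotient_map_stratum_proj:
  "quotient_map euclidean (stratum_topology \<xi> K L) (stratum_proj \<xi> K L)"
proof -
  have "topspace (stratum_topology \<xi> K L) = stratum \<xi> K L"
    unfolding stratum_topology_def by (rule topspace_coinduced_topology) (simp add: stratum_def)
  then show ?thesis
    unfolding quotient_map_def by (simp add: stratum_topology_def openin_coinduced_topology stratum_def)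
qed

text \<open>\<open>stratum_proj \<xi> K L\<close> and \<open>c_vec \<xi> L\<close> are quotient maps
  from the same space with the same fibres, so the induced bijection is a homeomorphism.\<close>

lemma homeomorphic_map_c_map_stratum_topology:
  assumes L: "L \<in> faces"
  shows "homeomorphic_map (stratum_topology \<xi> K L) (top_of_set (open_face \<xi> L)) (c_map \<xi> K)"
proof -
  have comp: "c_map \<xi> K \<circ> stratum_proj \<xi> K L = c_vec \<xi> L" by (simp add: fun_eq_iff c_map_proj)
  have q: "quotient_map euclidean (top_of_set (open_face \<xi> L)) (c_map \<xi> K \<circ> stratum_proj \<xi> K L)"
    unfolding comp by (rule quotient_map_c_vec[OF L])
  note p = quotient_map_stratum_proj[of L]
  have "continuous_map (stratum_topology \<xi> K L) (top_of_set (open_face \<xi> L)) (c_map \<xi> K)"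
    by (rule continuous_compose_quotient_map[OF p quotient_imp_continuous_map[OF q]])
  then have "quotient_map (stratum_topology \<xi> K L) (top_of_set (open_face \<xi> L)) (c_map \<xi> K)"
    by (rule quotient_map_from_composition[OF quotient_imp_continuous_map[OF p] _ q])
  moreover have "inj_on (c_map \<xi> K) (topspace (stratum_topology \<xi> K L))"
    unfolding quotient_imp_surjective_map[OF p, symmetric]
    by (auto simp: inj_on_def c_map_proj intro: softmax_eqD(2)[OF L L] c_vec_eqD[OF L L])
  ultimately show ?thesis by (simp add: homeomorphic_map_def)
qed

end

theorem theorem6p33:
  fixes B :: "'a::euclidean_space set"
    and m :: nat and K :: "nat set"
    and A :: "nat \<Rightarrow> 'a set"
    and \<xi> :: "nat \<Rightarrow> 'a \<Rightarrow>\<^sub>L real"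
  assumes "compact B" and "convex B" and "polyhedron B" and "0 \<in> interior B"
    and "K = {0..m}"
    and "bij_betw A K {F. F facet_of B}"
    and "\<And>j. j \<in> K \<Longrightarrow> A j = {v \<in> B. blinfun_apply (\<xi> j) v = 1}"
  shows "homeomorphic_map (bordification \<xi> K) (top_of_set (dual_polyhedron B))
           (c_map \<xi> K \<circ> Phi \<xi> K)
       \<and> homeomorphic_map (strata_topology \<xi> K) (top_of_set (dual_polyhedron B)) (c_map \<xi> K)
       \<and> (\<forall>L \<in> dual_faces \<xi> K \<union> {K}.
            homeomorphic_map (subtopology (strata_topology \<xi> K) (stratum \<xi> K L))
              (top_of_set (open_face \<xi> L)) (c_map \<xi> K)
          \<and> homeomorphic_map (stratum_topology \<xi> K L)
              (top_of_set (open_face \<xi> L)) (c_map \<xi> K))"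
proof -
  note B = \<open>polyhedron B\<close> \<open>0 \<in> interior B\<close>
  interpret polyhedral_norm K \<xi>
    using \<open>compact B\<close> \<open>K = {0..m}\<close>
    by (intro polyhedral_norm_facets[OF _ B _ \<open>bij_betw A K {F. F facet_of B}\<close> assms(7)])
      (auto intro: compact_imp_bounded)
  have "B = {u. \<forall>k\<in>K. blinfun_apply (\<xi> k) u \<le> 1}"
    by (rule polyhedron_eq_facet_functionals[OF B \<open>bij_betw A K {F. F facet_of B}\<close> assms(7)])
  then have "dual_polyhedron B = convex hull (\<xi> ` K)" using dual_polyhedron_eq by simp
  then show ?thesis
    using homeomorphic_map_c_map_Phi homeomorphic_map_c_map homeomorphic_map_c_map_subtopology
      homeomorphic_map_c_map_stratum_topology by simp
qed

end
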